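(* Let $\mathcal{M}=\{1^{m_1},\ldots,n^{m_n}\}$ with all $m_i\ge1$ and $M=m_1+\cdots+m_n$. There exists a bijection $\phi:\mathcal{T}_{\mathcal{M}}\to\mathcal{R}_{\mathcal{M}}$ which restricts to a bijection between $\mathcal{T}^0_{\mathcal{M}}$ and the set of pairs $(\pi,0)$ with $\pi\in\overline{\mathcal{Q}}_{\mathcal{M}}$ (i.e. with $\overline{\mathcal{Q}}_{\mathcal{M}}$), and such that whenever $\phi(T)=(\pi,k_j)$ we have $$\mathrm{cdes}(T)=\mathrm{des}(\pi),\qquad \mathrm{casc}(T)=\mathrm{asc}(\pi),\qquad \mathrm{leaf}^*(T)=\mathrm{plat}(\pi).$$
   Context: Quasi-Stirling permutations: $\overline{\mathcal{Q}}_{\mathcal{M}}$ is the set of permutations $\pi=\pi_1\cdots\pi_M$ of the multiset $\mathcal{M}$ containing no subsequence $abab$ with $a\ne b$. With $\pi_0=\pi_{M+1}=0$, $\mathrm{des}(\pi)$, $\mathrm{asc}(\pi)$, $\mathrm{plat}(\pi)$ count indices $0\le i\le M$ with $\pi_i>\pi_{i+1}$, $\pi_i<\pi_{i+1}$, $\pi_i=\pi_{i+1}$ respectively. Rooted quasi-Stirling permutations: $\mathcal{R}_{\mathcal{M}}$ is the set of pairs $(\pi,k_j)$ with $\pi\in\overline{\mathcal{Q}}_{\mathcal{M}}$ and either $k_j=0$, or $k_j$ designates the $j$-th copy (from the left) of the value $k$ in $\pi$ for some $1\le k\le n$ and $2\le j\le m_k$. VE-labeled trees: all trees are rooted plane trees,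 with edges directed toward the root; the edge from a vertex $v$ to its parent is said to start at $v$. Siblings are vertices with a common parent; the edges joining them to the parent are sibling edges. $\mathcal{T}_{\mathcal{M}}$ is the set of plane rooted trees with $M-\#\{i:m_i>1\}$ edges satisfying: (1) vertex labels are distinct and form exactly the set $\{0,1,\ldots,M-n\}\cup S_{\mathcal{M}}$, where $S_{\mathcal{M}}=\{s_i:m_i=1\}$ is a set of formal symbols; (2) a vertex has label $s_i$ iff it is a leaf whose edge to its parent has label $i$; (3) the edge labels form exactly the multiset $\mathcal{M}\setminus\{i\in[n]:m_i>1\}$ (each $i$ with $m_i>1$ appears $m_i-1$ times, each $i$ with $m_i=1$ once), and edges with the same label are adjacent sibling edges; (4) compatibility: edges with equal labels have their starting vertices increasingly labeled from left to right, and for two edges with labels $e_1\ne e_2$ starting at integer-labeled vertices $v_1,v_2$, $e_1<e_2$ iff $v_1<v_2$. $\mathcal{T}^0_{\mathcal{M}}$ is the subset of trees whose root is labeled $0$. Tree statistics: for a word $w=w_1\cdots w_r$, $\mathrm{cdes}(w)=\#\{i\in[r]:w_i>w_{i+1}\}$ and $\mathrm{casc}(w)=\#\{i\in[r]:w_i<w_{i+1}\}$ with the cyclic convention $w_{r+1}=w_1$. For a vertex $v$ of $T$ whose child edges are labeled $a_1,\ldots,a_d$ from left to right: if $v$ is the root, $\mathrm{cdes}(v)=\mathrm{des}(a_1\cdots a_d)$ and $\mathrm{casc}(v)=\mathrm{asc}(a_1\cdots a_d)$ (usual descents/ascents with boundary convention $a_0=a_{d+1}=0$); otherwise, with $b$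 the label of the edge from $v$ to its parent, $\mathrm{cdes}(v)=\mathrm{cdes}(ba_1\cdots a_d)$ and $\mathrm{casc}(v)=\mathrm{casc}(ba_1\cdots a_d)$. Then $\mathrm{cdes}(T)=\sum_v\mathrm{cdes}(v)$, $\mathrm{casc}(T)=\sum_v\mathrm{casc}(v)$, and $\mathrm{leaf}^*(T)$ is the number of leaves of $T$ with integer labels. *)

theory Defs
  imports Main "HOL-Library.Multiset" "HOL-Library.Sublist"
    "HOL-Combinatorics.Multiset_Permutations"
begin

definition multi :: "nat \<Rightarrow> (nat \<Rightarrow> nat) \<Rightarrow> nat multiset" where
  "multi n m = (\<Sum>i\<in>{1..n}. replicate_mset (m i) i)"

definition des :: "nat list \<Rightarrow> nat" where
  "des w = (let u = 0 # w @ [0] in card {i. i \<le> length w \<and> u ! i > u ! (i + 1)})"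

definition asc :: "nat list \<Rightarrow> nat" where
  "asc w = (let u = 0 # w @ [0] in card {i. i \<le> length w \<and> u ! i < u ! (i + 1)})"

definition plat :: "nat list \<Rightarrow> nat" where
  "plat w = (let u = 0 # w @ [0] in card {i. i \<le> length w \<and> u ! i = u ! (i + 1)})"

definition quasi_stirling :: "nat \<Rightarrow> (nat \<Rightarrow> nat) \<Rightarrow> nat list set" where
  "quasi_stirling n m =
    {\<pi> \<in> permutations_of_multiset (multi n m). \<forall>a b. a \<noteq> b \<longrightarrow> \<not> subseq [a, b, a, b] \<pi>}"

text \<open>\<open>Copy k j\<close> designates the \<open>j\<close>-th copy from the left of the value \<open>k\<close>, counting from 1;
  \<open>Zero\<close> is the mark \<open>0\<close>.\<close>

datatype mark = Zero | Copy nat nat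

definition rooted_quasi_stirling :: "nat \<Rightarrow> (nat \<Rightarrow> nat) \<Rightarrow> (nat list \<times> mark) set" where
  "rooted_quasi_stirling n m =
    quasi_stirling n m \<times> ({Zero} \<union> {Copy k j |k j. k \<in> {1..n} \<and> 2 \<le> j \<and> j \<le> m k})"

text \<open>\<open>SymL i\<close> is the formal symbol \<open>s\<^sub>i\<close>.\<close>

datatype vlabel = IntL nat | SymL nat

text \<open>A plane rooted tree with labels on vertices and edges. The list holds the children of the
  root from left to right, each paired with the label of the edge joining it to the root.\<close>

datatype vetree = Node (root_label: vlabel) (children: "(nat \<times> vetree) list")

text \<open>Every vertex of the tree appears once in this list, as the subtree hanging from it paired
  with the label of the edge to its parent (\<open>None\<close> for the root of the whole tree).\<close>

fun vertices_from :: "nat option \<Rightarrow> vetree \<Rightarrow> (nat option \<times> vetree) list" where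
  "vertices_from p (Node l cs) =
    (p, Node l cs) # concat (map (\<lambda>(e, t). vertices_from (Some e) t) cs)"

abbreviation vertices :: "vetree \<Rightarrow> (nat option \<times> vetree) list" where
  "vertices T \<equiv> vertices_from None T"

text \<open>The edges, each given as its label paired with the subtree at its starting vertex.\<close>

definition edges :: "vetree \<Rightarrow> (nat \<times> vetree) list" where
  "edges T = concat (map (\<lambda>(p, t). children t) (vertices T))"

abbreviation child_labels :: "vetree \<Rightarrow> nat list" where
  "child_labels t \<equiv> map fst (children t)"

definition singles :: "nat \<Rightarrow> (nat \<Rightarrow> nat) \<Rightarrow> nat set" where
  "singles n m = {i \<in> {1..n}. m i = 1}"

definition multiples :: "nat \<Rightarrow> (nat \<Rightarrow> nat) \<Rightarrow> nat set" where
  "multiples n m = {i \<in> {1..n}. m i > 1}"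

definition vertex_labels_ok :: "nat \<Rightarrow> (nat \<Rightarrow> nat) \<Rightarrow> vetree \<Rightarrow> bool" where
  "vertex_labels_ok n m T \<longleftrightarrow>
    (let ls = map (\<lambda>(p, t). root_label t) (vertices T) in
      distinct ls \<and>
      set ls = IntL ` {0..size (multi n m) - n} \<union> SymL ` singles n m)"

definition symbols_ok :: "nat \<Rightarrow> (nat \<Rightarrow> nat) \<Rightarrow> vetree \<Rightarrow> bool" where
  "symbols_ok n m T \<longleftrightarrow>
    (\<forall>(p, t) \<in> set (vertices T). \<forall>i \<in> singles n m.
      root_label t = SymL i \<longleftrightarrow> children t = [] \<and> p = Some i)"

text \<open>The last two conjuncts say that edges with the same label are adjacent siblings: a label
  occurs below one vertex only, and there it occupies consecutive positions. Comparing parents by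
  equality of subtrees is sound only together with \<^const>\<open>vertex_labels_ok\<close>, by which distinct
  vertices carry distinct subtrees.\<close>

definition edge_labels_ok :: "nat \<Rightarrow> (nat \<Rightarrow> nat) \<Rightarrow> vetree \<Rightarrow> bool" where
  "edge_labels_ok n m T \<longleftrightarrow>
    mset (map fst (edges T)) = multi n m - mset_set (multiples n m) \<and>
    (\<forall>(p, t) \<in> set (vertices T). \<forall>(q, u) \<in> set (vertices T).
      set (child_labels t) \<inter> set (child_labels u) \<noteq> {} \<longrightarrow> t = u) \<and>
    (\<forall>(p, t) \<in> set (vertices T). \<forall>i j k.
      i < j \<and> j < k \<and> k < length (children t) \<and> child_labels t ! i = child_labels t ! k \<longrightarrow>
      child_labels t ! j = child_labels t ! i)"

text \<open>In the first conjunct it suffices to look at siblings, since edges with equal labels are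
  siblings by \<^const>\<open>edge_labels_ok\<close>.\<close>

definition compatible :: "vetree \<Rightarrow> bool" where
  "compatible T \<longleftrightarrow>
    (\<forall>(p, t) \<in> set (vertices T). \<forall>i j.
      i < j \<and> j < length (children t) \<and> child_labels t ! i = child_labels t ! j \<longrightarrow>
      (\<exists>x y. root_label (snd (children t ! i)) = IntL x \<and>
             root_label (snd (children t ! j)) = IntL y \<and> x < y)) \<and>
    (\<forall>(e1, t1) \<in> set (edges T). \<forall>(e2, t2) \<in> set (edges T). \<forall>x y.
      e1 \<noteq> e2 \<and> root_label t1 = IntL x \<and> root_label t2 = IntL y \<longrightarrow> (e1 < e2 \<longleftrightarrow> x < y))"

definition ve_trees :: "nat \<Rightarrow> (nat \<Rightarrow> nat) \<Rightarrow> vetree set" where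
  "ve_trees n m =
    {T. length (edges T) = size (multi n m) - card (multiples n m) \<and>
        vertex_labels_ok n m T \<and> symbols_ok n m T \<and> edge_labels_ok n m T \<and> compatible T}"

definition ve_trees0 :: "nat \<Rightarrow> (nat \<Rightarrow> nat) \<Rightarrow> vetree set" where
  "ve_trees0 n m = {T \<in> ve_trees n m. root_label T = IntL 0}"

definition cdes_word :: "nat list \<Rightarrow> nat" where
  "cdes_word w = card {i. i < length w \<and> w ! i > w ! ((i + 1) mod length w)}"

definition casc_word :: "nat list \<Rightarrow> nat" where
  "casc_word w = card {i. i < length w \<and> w ! i < w ! ((i + 1) mod length w)}"

fun cdes_vertex :: "nat option \<times> vetree \<Rightarrow> nat" where
  "cdes_vertex (None, t) = des (child_labels t)"
| "cdes_vertex (Some b, t) = cdes_word (b # child_labels t)"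

fun casc_vertex :: "nat option \<times> vetree \<Rightarrow> nat" where
  "casc_vertex (None, t) = asc (child_labels t)"
| "casc_vertex (Some b, t) = casc_word (b # child_labels t)"

definition cdes :: "vetree \<Rightarrow> nat" where
  "cdes T = (\<Sum>v\<leftarrow>vertices T. cdes_vertex v)"

definition casc :: "vetree \<Rightarrow> nat" where
  "casc T = (\<Sum>v\<leftarrow>vertices T. casc_vertex v)"

text \<open>A leaf is a vertex without children, so the root of a one-vertex tree counts. This matters
  only for \<open>n = 0\<close>, where the empty permutation has one plateau.\<close>

definition leaf_star :: "vetree \<Rightarrow> nat" where
  "leaf_star T =
    length (filter (\<lambda>(p, t). children t = [] \<and> (\<exists>x. root_label t = IntL x)) (vertices T))"

end

(* The copies of k in a quasi-Stirling permutation bound m_k - 1 gaps, and the absence of abab means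
   that these gaps are nested or disjoint. The gaps are therefore the non-root integer-labeled
   vertices of a plane tree, the edge above a gap between copies of k being labeled k; a value with
   m_k = 1 becomes a leaf. Reading the word around a gap bounded by k visits k, the labels of its
   child edges, and k again, so cyclic descents and ascents at the vertex are descents and ascents of
   the word, and a gap that is a leaf is a plateau. Compatibility forces the integer labels of the
   non-root vertices once the root label is known: they are the remaining integers, dealt out in
   order of the edge labels. Hence the trees with a fixed root label r correspond to the
   quasi-Stirling permutations, and any bijection from the M - n + 1 possible root labels to the
   marks that sends 0 to the mark 0 yields the claim; no re-rooting is needed, as the statistics
   do not depend on the vertex labels. *)
theory Submission imports Defs
begin

section \<open>Words of forests\<close>

text \<open>Consecutive gaps between copies of \<open>k\<close> share the copy that separates them,
  so for \<open>m_k > 1\<close> a row of \<open>m_k - 1\<close> sibling edges accounts for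
  \<open>m_k\<close> letters, and the letters written for an edge depend on its left neighbour. This
  is why \<open>word\<close>, \<open>clustered\<close> and \<open>decode\<close> carry an optional
  label: within a run of equal siblings the next gap is already open. The same device turns the
  conditions on a tree, which compare arbitrary pairs of vertices, into a recursion over the first
  subtree and the remaining siblings; translating between the two forms is most of the work on the
  tree side. The integers at the vertices stay outside this correspondence: \<open>decode\<close>
  receives them as a parameter \<open>Y\<close>, and only afterwards is \<open>Y\<close> chosen as
  \<open>canonical_labels r\<close>.\<close>

type_synonym forest = "(nat \<times> vetree) list"

fun forest_edges :: "forest \<Rightarrow> (nat \<times> vetree) list" where
  "forest_edges [] = []"
| "forest_edges ((e, Node l cs) # r) = (e, Node l cs) # forest_edges cs @ forest_edges r"

abbreviation forest_labels :: "forest \<Rightarrow> nat set" where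
  "forest_labels cs \<equiv> fst ` set (forest_edges cs)"

text \<open>Preorder lists siblings from left to right, so for edges that share label and parent
  this is the row of labels that compatibility compares.\<close>

definition labels_at :: "nat \<Rightarrow> forest \<Rightarrow> vlabel list" where
  "labels_at e cs = map (root_label \<circ> snd) (filter (\<lambda>x. fst x = e) (forest_edges cs))"

text \<open>The first argument is the label of the edge to the left: an edge with that label continues a
  run of equal siblings, whose leading letter has been read already.\<close>

fun word :: "nat option \<Rightarrow> forest \<Rightarrow> nat list" where
  "word p [] = []"
| "word p ((e, Node l cs) # r) =
    (if p = Some e then [] else [e]) @
    (case l of SymL _ \<Rightarrow> [] | IntL _ \<Rightarrow> word None cs @ [e]) @ word (Some e) r"

text \<open>With a label \<open>k\<close> of the edge to the left as first argument, \<open>k\<close> may recur only in a run at the head of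
  the forest.\<close>

fun clustered :: "nat option \<Rightarrow> forest \<Rightarrow> bool" where
  "clustered p [] \<longleftrightarrow> True"
| "clustered p ((e, Node l cs) # r) \<longleftrightarrow>
    (\<forall>k. p = Some k \<longrightarrow> k \<noteq> e \<longrightarrow> k \<notin> forest_labels cs \<union> forest_labels r) \<and>
    e \<notin> forest_labels cs \<and> forest_labels cs \<inter> forest_labels r = {} \<and>
    (\<forall>i. l = SymL i \<longrightarrow> i = e \<and> cs = [] \<and> p \<noteq> Some e \<and> e \<notin> forest_labels r) \<and>
    clustered None cs \<and> clustered (Some e) r"

text \<open>\<open>Y k\<close> lists the labels still to be given to the vertices below the \<open>k\<close>-edges, from left to
  right. In the state \<open>Some k\<close> a copy of \<open>k\<close> has just been read.\<close>

function decode :: "(nat \<Rightarrow> vlabel list) \<Rightarrow> nat option \<Rightarrow> nat list \<Rightarrow> forest" where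
  "decode Y None [] = []"
| "decode Y None (k # w) =
    (if k \<in> set w then decode Y (Some k) w
     else (k, Node (SymL k) []) # decode Y None w)"
| "decode Y (Some k) w =
    (if k \<in> set w
     then (k, Node (hd (Y k)) (decode Y None (takeWhile (\<lambda>x. x \<noteq> k) w))) #
       decode (Y(k := tl (Y k))) (Some k) (tl (dropWhile (\<lambda>x. x \<noteq> k) w))
     else decode Y None w)"
  by pat_completeness auto
termination
\<comment> \<open>Leaving the state \<open>Some k\<close> reads no letter, so the state itself must
  count; letters weigh two so that entering it still decreases the measure.\<close>
proof (relation "measure (\<lambda>(Y, p, w). 2 * length w + (if p = None then 0 else 1))", goal_cases)
  case (4 Y k w)
  then show ?case using length_takeWhile_le[of "\<lambda>x. x \<noteq> k" w] by simp
next
  case (5 Y k w)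
  then have "dropWhile (\<lambda>x. x \<noteq> k) w \<noteq> []" by auto
  then have "length (tl (dropWhile (\<lambda>x. x \<noteq> k) w)) < length w"
    using length_dropWhile_le[of "\<lambda>x. x \<noteq> k" w]
    by (cases "dropWhile (\<lambda>x. x \<noteq> k) w") auto
  then show ?case by simp
qed auto

declare decode.simps(3) [simp del]

lemma decode_Some_split:
  assumes "k \<notin> set u"
  shows "decode Y (Some k) (u @ k # v) =
    (k, Node (hd (Y k)) (decode Y None u)) # decode (Y(k := tl (Y k))) (Some k) v"
proof -
  have "takeWhile (\<lambda>x. x \<noteq> k) (u @ k # v) = u" "dropWhile (\<lambda>x. x \<noteq> k) (u @ k # v) = k # v"
    using assms by (auto simp: takeWhile_append dropWhile_append)
  then show ?thesis by (simp add: decode.simps(3))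
qed

lemma decode_Some_notin: "k \<notin> set w \<Longrightarrow> decode Y (Some k) w = decode Y None w"
  by (simp add: decode.simps(3))

lemma forest_induct [case_names Nil Cons]:
  assumes "P []" and "\<And>e l cs r. P cs \<Longrightarrow> P r \<Longrightarrow> P ((e, Node l cs) # r)"
  shows "P (cs :: forest)"
  by (rule forest_edges.induct) (use assms in auto)

text \<open>Follows the optional argument through the recursion: it is reset below an edge and
  becomes \<open>Some e\<close> to the right of an \<open>e\<close>-edge.\<close>

lemma forest_induct2 [case_names Nil Cons]:
  assumes "\<And>p. P p []"
    and "\<And>p e l cs r. P None cs \<Longrightarrow> P (Some e) r \<Longrightarrow> P p ((e, Node l cs) # r)"
  shows "P p (cs :: forest)"
proof -
  have "\<forall>p. P p cs"
    by (induction cs rule: forest_induct) (use assms in auto)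
  then show ?thesis ..
qed

lemma labels_at_Nil [simp]: "labels_at e [] = []"
  by (simp add: labels_at_def)

lemma labels_at_Cons [simp]:
  "labels_at e ((x, Node l cs) # r) =
    (if x = e then [l] else []) @ labels_at e cs @ labels_at e r"
  by (simp add: labels_at_def)

lemma labels_at_eq_Nil_iff: "labels_at e cs = [] \<longleftrightarrow> e \<notin> forest_labels cs"
  by (auto simp: labels_at_def filter_empty_conv)

lemma labels_at_notin [simp]: "e \<notin> forest_labels cs \<Longrightarrow> labels_at e cs = []"
  by (simp add: labels_at_eq_Nil_iff)

lemma clustered_Some_notin:
  "k \<notin> forest_labels cs \<Longrightarrow> clustered (Some k) cs \<longleftrightarrow> clustered None cs"
  by (induction cs rule: forest_induct) auto

lemma word_Some_notin: "k \<notin> forest_labels cs \<Longrightarrow> word (Some k) cs = word None cs"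
  by (induction cs rule: forest_induct) auto

text \<open>No label is lost: a vertex with a formal symbol is a leaf whose edge does not continue a
  run, and any other vertex writes its label when its gap closes.\<close>

lemma set_word: "clustered p cs \<Longrightarrow> set (word p cs) = forest_labels cs"
proof (induction p cs rule: forest_induct2)
  case (Cons p e l cs r)
  then show ?case by (cases l) auto
qed auto

text \<open>Each integer vertex accounts for the copy that closes its gap; the extra copy is the one
  that opens the run, unless it has been read already.\<close>

lemma count_word:
  "clustered p cs \<Longrightarrow> count (mset (word p cs)) x =
    length (filter (\<lambda>l. l \<in> range IntL) (labels_at x cs)) +
    (if p \<noteq> Some x \<and> x \<in> forest_labels cs then 1 else 0)"
proof (induction p cs rule: forest_induct2)
  case (Cons p e l cs r)
  show ?case
  proof (cases "x = e")
    case True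
    then have "labels_at x cs = []" "x \<notin> set (word None cs)"
      using Cons.prems set_word[of None cs] by auto
    moreover have "count (mset (word (Some e) r)) x =
        length (filter (\<lambda>l. l \<in> range IntL) (labels_at x r))"
      using Cons True by simp
    ultimately show ?thesis
      using True Cons.prems by (cases l) (auto simp: count_eq_zero_iff)
  next
    case False
    then show ?thesis using Cons by (cases l) auto
  qed
qed auto

section \<open>Noncrossing words\<close>

text \<open>Call two positions equivalent if they carry the same letter: the resulting set partition
  of the positions is noncrossing in the usual sense.\<close>

definition noncrossing :: "'a list \<Rightarrow> bool" where
  "noncrossing w \<longleftrightarrow> (\<forall>a b. a \<noteq> b \<longrightarrow> \<not> subseq [a, b, a, b] w)"

lemma noncrossing_subseq: "noncrossing w \<Longrightarrow> subseq v w \<Longrightarrow> noncrossing v"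
  unfolding noncrossing_def using subseq_order.trans by blast

lemma subseq_in_set: "subseq xs ys \<Longrightarrow> x \<in> set xs \<Longrightarrow> x \<in> set ys"
  by (induction rule: list_emb.induct) auto

lemma subseq_drop_prefix: "subseq (x # xs) (u @ v) \<Longrightarrow> x \<notin> set u \<Longrightarrow> subseq (x # xs) v"
  by (induction u) (auto dest: subseq_Cons2_neq)

lemma subseq_drop_suffix:
  assumes "subseq (xs @ [x]) (u @ v)" "x \<notin> set v"
  shows "subseq (xs @ [x]) u"
proof -
  obtain ys zs where *: "xs @ [x] = ys @ zs" "subseq ys u" "subseq zs v"
    using assms(1) by (auto simp: subseq_append_iff)
  have "zs = []"
  proof (rule ccontr)
    assume "zs \<noteq> []"
    then have "x \<in> set zs"
      using arg_cong[OF *(1), of last] last_in_set[of zs] by simp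
    then show False
      using *(3) assms(2) subseq_in_set by metis
  qed
  then show ?thesis using * by simp
qed

lemma subseq_drop_middle:
  assumes "subseq xs (u @ v @ w)" "set xs \<inter> set v = {}"
  shows "subseq xs (u @ w)"
proof -
  have "subseq (filter (\<lambda>x. x \<notin> set v) xs) (filter (\<lambda>x. x \<notin> set v) (u @ v @ w))"
    using assms(1) by (rule subseq_filter)
  moreover have "filter (\<lambda>x. x \<notin> set v) xs = xs"
    using assms(2) by (auto simp: filter_id_conv)
  moreover have "subseq (filter (\<lambda>x. x \<notin> set v) (u @ v @ w)) (u @ w)"
    by (auto intro!: list_emb_append_mono simp: filter_empty_conv)
  ultimately show ?thesis by (metis subseq_order.trans)
qed

lemma noncrossing_Cons:
  assumes "noncrossing w" "k \<notin> set w"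
  shows "noncrossing (k # w)"
  unfolding noncrossing_def
proof (intro allI impI notI)
  fix a b assume "a \<noteq> b" and *: "subseq [a, b, a, b] (k # w)"
  show False
  proof (cases "a = k")
    case True
    then have "subseq [b, k, b] w" using * by simp
    from subseq_in_set[OF this, of k] show False using assms(2) by simp
  next
    case False
    then have "subseq [a, b, a, b] w" using * by simp
    then show False using assms(1) \<open>a \<noteq> b\<close> by (auto simp: noncrossing_def)
  qed
qed

text \<open>The letters of \<open>u\<close> occur in that segment only, so a letter lying between
  two copies of one of them is itself in \<open>u\<close>. A forbidden pattern thus uses only
  letters of \<open>u\<close>, or none, and in the latter case \<open>u\<close> can be
  deleted.\<close>

lemma noncrossing_insert:
  assumes "noncrossing u" "noncrossing (k # v)" "k \<notin> set u" "set u \<inter> set v = {}"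
  shows "noncrossing (k # u @ k # v)"
  unfolding noncrossing_def
proof (intro allI impI notI)
  fix a b assume "a \<noteq> b" and ab: "subseq [a, b, a, b] (k # u @ k # v)"
  have 1: False if "a' \<noteq> b'" "subseq [a', b', a', b'] (k # u @ k # v)" "a' \<in> set u" "b' \<in> set u"
    for a' b'
  proof -
    have "subseq (a' # [b', a', b']) ([k] @ (u @ k # v))" using that by simp
    then have "subseq (a' # [b', a', b']) (u @ k # v)"
      by (rule subseq_drop_prefix) (use that assms in auto)
    then have "subseq ([a', b', a'] @ [b']) (u @ k # v)" by simp
    then have "subseq ([a', b', a'] @ [b']) u"
      by (rule subseq_drop_suffix) (use that assms in auto)
    then show False using assms(1) that by (auto simp: noncrossing_def)
  qed
  have 2: "b' \<in> set u" if "subseq [a', b', a'] (k # u @ k # v)" "a' \<in> set u" for a' b'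
  proof -
    have "subseq (a' # [b', a']) ([k] @ (u @ k # v))" using that by simp
    then have "subseq (a' # [b', a']) (u @ k # v)"
      by (rule subseq_drop_prefix) (use that assms in auto)
    then have "subseq ([a', b'] @ [a']) (u @ k # v)" by simp
    then have "subseq ([a', b'] @ [a']) u"
      by (rule subseq_drop_suffix) (use that assms in auto)
    then show ?thesis by (rule subseq_in_set) simp
  qed
  have aba: "subseq [a, b, a] (k # u @ k # v)" and bab: "subseq [b, a, b] (k # u @ k # v)"
    by (rule subseq_order.trans[OF _ ab], simp)+
  show False
  proof (cases "a \<in> set u \<or> b \<in> set u")
    case True
    then show False using 1[OF \<open>a \<noteq> b\<close> ab] 2[OF aba] 2[OF bab] by blast
  next
    case False
    have "subseq [a, b, a, b] ([k] @ u @ k # v)" using ab by simp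
    then have "subseq [a, b, a, b] ([k] @ k # v)"
      by (rule subseq_drop_middle) (use False in auto)
    \<comment> \<open>Neighbouring letters of the pattern differ, so it uses at most one of two
      adjacent copies of \<open>k\<close>.\<close>
    then have "subseq [a, b, a, b] (k # v)"
      using \<open>a \<noteq> b\<close> by (auto split: if_splits)
    then show False using assms(2) \<open>a \<noteq> b\<close> by (auto simp: noncrossing_def)
  qed
qed

text \<open>A letter \<open>b\<close> common to \<open>u\<close> and \<open>v\<close> would give
  \<open>k b k b\<close>. This is what lets \<open>decode\<close> treat the inside of a gap and the
  rest of the word separately.\<close>

lemma noncrossing_insertD:
  assumes "noncrossing (k # u @ k # v)" "k \<notin> set u"
  shows "noncrossing u" "noncrossing (k # v)" "set u \<inter> set v = {}"
proof -
  show "noncrossing u"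
    using assms(1) by (rule noncrossing_subseq) (simp add: list_emb_Cons subseq_rev_drop_many)
  show "noncrossing (k # v)"
    using assms(1) by (rule noncrossing_subseq) (simp add: list_emb_Cons subseq_drop_many)
  show "set u \<inter> set v = {}"
  proof (rule ccontr)
    assume "set u \<inter> set v \<noteq> {}"
    then obtain b where b: "b \<in> set u" "b \<in> set v" by auto
    then have "subseq ([k] @ [b] @ [k] @ [b]) ([k] @ u @ [k] @ v)"
      by (intro list_emb_append_mono) (auto simp: subseq_singleton_left)
    then have "subseq [k, b, k, b] (k # u @ k # v)" by simp
    moreover have "k \<noteq> b" using assms(2) b by auto
    ultimately show False using assms(1) unfolding noncrossing_def by blast
  qed
qed

text \<open>The prefixed letter is the copy read before the state was entered; the induction needs
  to know that the remaining word does not cross it either.\<close>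

lemma noncrossing_word:
  "clustered p cs \<Longrightarrow> noncrossing ((case p of None \<Rightarrow> [] | Some k \<Rightarrow> [k]) @ word p cs)"
proof (induction p cs rule: forest_induct2)
  case (Nil p)
  then show ?case
    by (auto simp: noncrossing_def split: option.splits if_splits)
next
  case (Cons p e l cs r)
  let ?w = "e # (case l of SymL _ \<Rightarrow> [] | IntL _ \<Rightarrow> word None cs @ [e]) @ word (Some e) r"
  have sets: "set (word None cs) = forest_labels cs" "set (word (Some e) r) = forest_labels r"
    using Cons.prems set_word by auto
  have "noncrossing ?w"
    using Cons sets by (cases l) (auto intro!: noncrossing_insert)
  moreover have "k \<notin> set ?w" if "p = Some k" "k \<noteq> e" for k
    using Cons.prems that sets by (cases l) auto
  ultimately show ?case
    by (cases p) (auto intro: noncrossing_Cons)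
qed

section \<open>Words and forests determine each other\<close>

text \<open>\<open>Y\<close> is constrained only at labels that occur. Hence the same
  \<open>Y\<close> serves the subtree, and the siblings to the right after the head of
  \<open>Y e\<close> has been dropped.\<close>

lemma decode_word:
  assumes "clustered p cs" "\<forall>e\<in>forest_labels cs. labels_at e cs = Y e"
  shows "decode Y p (word p cs) = cs"
  using assms
proof (induction p cs arbitrary: Y rule: forest_induct2)
  case (Nil p)
  then show ?case by (cases p) (auto simp: decode_Some_notin)
next
  case (Cons p e l cs r)
  have cl: "e \<notin> forest_labels cs" "forest_labels cs \<inter> forest_labels r = {}"
    "clustered None cs" "clustered (Some e) r"
    using Cons.prems(1) by auto
  have sets: "set (word None cs) = forest_labels cs" "set (word (Some e) r) = forest_labels r"
    using cl set_word by auto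
  have cs: "\<forall>x\<in>forest_labels cs. labels_at x cs = Y x"
  proof
    fix x assume "x \<in> forest_labels cs"
    then have "x \<noteq> e" "x \<notin> forest_labels r" using cl by blast+
    moreover have "x \<in> forest_labels ((e, Node l cs) # r)"
      using \<open>x \<in> forest_labels cs\<close> by auto
    ultimately show "labels_at x cs = Y x"
      using bspec[OF Cons.prems(2), of x] by simp
  qed
  have Ye: "Y e = l # labels_at e r"
    using Cons.prems(2) cl by simp
  have r: "\<forall>x\<in>forest_labels r. labels_at x r = (Y(e := tl (Y e))) x"
  proof
    fix x assume x: "x \<in> forest_labels r"
    then have "x \<notin> forest_labels cs" using cl by blast
    moreover have "x \<in> forest_labels ((e, Node l cs) # r)"
      using x by auto
    ultimately show "labels_at x r = (Y(e := tl (Y e))) x"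
      using bspec[OF Cons.prems(2), of x] Ye by (cases "x = e") simp_all
  qed
  \<comment> \<open>A run that the first edge does not continue is over for good, so its state may
    be forgotten.\<close>
  have ends: "decode Y p w = decode Y None w" if "p \<noteq> Some e" "set w \<subseteq> forest_labels ((e, Node l cs) # r)" for w
    using that Cons.prems(1) by (cases p) (auto intro!: decode_Some_notin)
  show ?case
  proof (cases l)
    case (IntL i)
    have "decode (Y(e := tl (Y e))) (Some e) (word (Some e) r) = r"
      by (rule Cons.IH(2)[OF cl(4) r])
    then have "decode Y (Some e) (word None cs @ e # word (Some e) r) = (e, Node l cs) # r"
      using Cons.IH(1)[OF cl(3) cs] Ye cl(1) sets
      by (simp add: decode_Some_split)
    then show ?thesis
      using IntL ends[of "e # word None cs @ e # word (Some e) r"] sets by (cases "p = Some e") auto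
  next
    case (SymL i)
    then have *: "i = e" "cs = []" "p \<noteq> Some e" "e \<notin> forest_labels r"
      using Cons.prems(1) by auto
    \<comment> \<open>\<open>decode\<close> writes a formal symbol without consulting
      \<open>Y\<close>, so here nothing is taken from \<open>Y e\<close>.\<close>
    have "\<forall>x\<in>forest_labels r. labels_at x r = Y x"
      using r *(4) by auto
    then have "decode Y (Some e) (word (Some e) r) = r"
      using Cons.IH(2) cl(4) by blast
    then show ?thesis
      using SymL * sets ends[of "e # word (Some e) r"] by (auto simp: decode_Some_notin)
  qed
qed

text \<open>Every copy that closes a gap uses up one label. So a letter whose run is open has as
  many labels left as copies, while an unread letter has one label fewer, or a single copy and its
  formal symbol.\<close>

lemma decode_correct:
  assumes "noncrossing ((case p of None \<Rightarrow> [] | Some k \<Rightarrow> [k]) @ w)"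
    and "\<And>e. e \<in> set w \<Longrightarrow> p = Some e \<Longrightarrow>
      length (Y e) = count (mset w) e \<and> set (Y e) \<subseteq> range IntL"
    and "\<And>e. e \<in> set w \<Longrightarrow> p \<noteq> Some e \<Longrightarrow>
      count (mset w) e = 1 \<and> Y e = [SymL e] \<or>
      count (mset w) e > 1 \<and> Suc (length (Y e)) = count (mset w) e \<and> set (Y e) \<subseteq> range IntL"
  shows "word p (decode Y p w) = w \<and> clustered p (decode Y p w) \<and>
    (\<forall>e\<in>set w. labels_at e (decode Y p w) = Y e)"
  using assms
proof (induction Y p w rule: decode.induct)
  case (1 Y)
  then show ?case by simp
next
  case (2 Y k w)
  show ?case
  proof (cases "k \<in> set w")
    case True
    let ?D = "decode Y (Some k) w"
    have "word (Some k) ?D = w \<and> clustered (Some k) ?D \<and> (\<forall>e\<in>set w. labels_at e ?D = Y e)"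
    proof (rule "2.IH"(1)[OF True], goal_cases)
      case 1
      then show ?case using "2.prems"(1) by simp
    next
      case (2 e)
      then show ?case using "2.prems"(3)[of e] by auto
    next
      case (3 e)
      then show ?case using "2.prems"(3)[of e] by auto
    qed
    \<comment> \<open>The decoded forest begins with a \<open>k\<close>-edge, so changing the state
      to \<open>None\<close> just puts the opening \<open>k\<close> in front of its word.\<close>
    moreover obtain l c r where "?D = (k, Node l c) # r"
      using split_list_first[OF True] by (auto simp: decode_Some_split)
    ultimately show ?thesis using True by auto
  next
    case False
    let ?D = "decode Y None w"
    have *: "word None ?D = w \<and> clustered None ?D \<and> (\<forall>e\<in>set w. labels_at e ?D = Y e)"
    proof (rule "2.IH"(2)[OF False], goal_cases)
      case 1
      have "subseq w (k # w)" by auto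
      then show ?case using "2.prems"(1) by (auto intro: noncrossing_subseq)
    next
      case (2 e)
      then show ?case by simp
    next
      case (3 e)
      then have "k \<noteq> e" using False by auto
      then show ?case using 3 "2.prems"(3)[of e] by simp
    qed
    then have "k \<notin> forest_labels ?D" using False set_word[of None ?D] by auto
    moreover have "Y k = [SymL k]"
      using "2.prems"(3)[of k] False by (auto simp: count_eq_zero_iff[THEN iffD2])
    ultimately show ?thesis
      using False * by (auto simp: word_Some_notin clustered_Some_notin)
  qed
next
  case (3 Y k w)
  show ?case
  proof (cases "k \<in> set w")
    case True
    then obtain u v where w: "w = u @ k # v" "k \<notin> set u"
      using split_list_first by metis
    have tw: "takeWhile (\<lambda>x. x \<noteq> k) w = u" "tl (dropWhile (\<lambda>x. x \<noteq> k) w) = v"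
      using w by (auto simp: takeWhile_append dropWhile_append)
    have nc: "noncrossing u" "noncrossing (k # v)" "set u \<inter> set v = {}"
      using noncrossing_insertD[of k u v] w "3.prems"(1) by auto
    let ?U = "decode Y None u" and ?V = "decode (Y(k := tl (Y k))) (Some k) v"
    have Yk: "length (Y k) = Suc (count (mset v) k)" "set (Y k) \<subseteq> range IntL"
      using "3.prems"(2)[of k] w by (auto simp: count_eq_zero_iff[THEN iffD2])
    have U: "word None ?U = u \<and> clustered None ?U \<and> (\<forall>e\<in>set u. labels_at e ?U = Y e)"
    proof (rule "3.IH"(1)[OF True, unfolded tw], goal_cases)
      case 1
      then show ?case using nc by simp
    next
      case (2 e)
      then show ?case by simp
    next
      case (3 e)
      then have "e \<notin> set v" "e \<noteq> k" using nc w by auto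
      then show ?case
        using "3.prems"(3)[of e] w 3 by (auto simp: count_eq_zero_iff[THEN iffD2])
    qed
    have V: "word (Some k) ?V = v \<and> clustered (Some k) ?V \<and>
      (\<forall>e\<in>set v. labels_at e ?V = (Y(k := tl (Y k))) e)"
    proof (rule "3.IH"(2)[OF True, unfolded tw], goal_cases)
      case 1
      then show ?case using nc by simp
    next
      case (2 e)
      then show ?case using Yk list.set_sel(2)[of "Y k"] by (cases "Y k") auto
    next
      case (3 e)
      then have "e \<notin> set u" "e \<noteq> k" using nc w by auto
      then show ?case
        using "3.prems"(3)[of e] w 3 by (auto simp: count_eq_zero_iff[THEN iffD2])
    qed
    have sets: "forest_labels ?U = set u" "forest_labels ?V = set v"
      using U V set_word by metis+
    obtain i where i: "hd (Y k) = IntL i" "Y k = hd (Y k) # tl (Y k)"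
      using Yk by (cases "Y k") auto
    \<comment> \<open>The induction hypothesis covers the letters of \<open>v\<close> only; if
      \<open>k\<close> does not recur there, its labels must be exhausted.\<close>
    have k: "labels_at k ?V = tl (Y k)"
    proof (cases "k \<in> set v")
      case False
      then have "tl (Y k) = []" using Yk by (cases "Y k") (auto simp: count_eq_zero_iff[THEN iffD2])
      then show ?thesis using False sets by simp
    qed (use V in simp)
    have "labels_at e (decode Y (Some k) w) = Y e" if e: "e \<in> set w" for e
    proof (cases "e = k")
      case True
      then show ?thesis using w k i sets by (simp add: decode_Some_split)
    next
      case False
      then consider "e \<in> set u" "e \<notin> set v" | "e \<in> set v" "e \<notin> set u"
        using e w nc by auto
      then show ?thesis
        using w U V False sets by cases (simp_all add: decode_Some_split)
    qed
    then show ?thesis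
      using U V w sets i nc by (auto simp: decode_Some_split)
  next
    case False
    let ?D = "decode Y None w"
    have *: "word None ?D = w \<and> clustered None ?D \<and> (\<forall>e\<in>set w. labels_at e ?D = Y e)"
    proof (rule "3.IH"(3)[OF False], goal_cases)
      case 1
      have "subseq w (k # w)" by auto
      then show ?case using "3.prems"(1) by (auto intro: noncrossing_subseq)
    next
      case (2 e)
      then show ?case by simp
    next
      case (3 e)
      then have "k \<noteq> e" using False by auto
      then show ?case using 3 "3.prems"(3)[of e] by simp
    qed
    then have "k \<notin> forest_labels ?D" using False set_word[of None ?D] by auto
    then show ?thesis
      using False * by (auto simp: word_Some_notin clustered_Some_notin decode_Some_notin)
  qed
qed

section \<open>Descents, ascents and plateaus\<close>

fun adj_count :: "('a \<Rightarrow> 'a \<Rightarrow> bool) \<Rightarrow> 'a list \<Rightarrow> nat" where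
  "adj_count P (x # y # zs) = (if P x y then 1 else 0) + adj_count P (y # zs)"
| "adj_count P zs = 0"

lemma adj_count_eq_card:
  "adj_count P xs = card {i. Suc i < length xs \<and> P (xs ! i) (xs ! Suc i)}"
proof (induction P xs rule: adj_count.induct)
  case (1 P x y zs)
  let ?A = "{i. Suc i < length (y # zs) \<and> P ((y # zs) ! i) ((y # zs) ! Suc i)}"
  have "{i. Suc i < length (x # y # zs) \<and> P ((x # y # zs) ! i) ((x # y # zs) ! Suc i)} =
      (if P x y then {0} else {}) \<union> Suc ` ?A" (is "?B = ?C")
  proof (rule set_eqI)
    show "i \<in> ?B \<longleftrightarrow> i \<in> ?C" for i by (cases i) auto
  qed
  moreover have "card (Suc ` ?A) = card ?A" by (simp add: card_image)
  moreover have "finite ?A" by (rule finite_subset[of _ "{..<length (y # zs)}"]) auto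
  ultimately show ?case
    using 1 by (auto simp: card_insert_if)
qed auto

text \<open>The letter at the cut stays in both pieces, so each adjacent pair is counted once. Words
  are cut this way at the copies bounding a gap.\<close>

lemma adj_count_append:
  "adj_count P (xs @ y # zs) = adj_count P (xs @ [y]) + adj_count P (y # zs)"
proof (induction xs)
  case (Cons x xs)
  then show ?case by (cases xs) auto
qed auto

lemma boundary_card_eq_adj_count:
  "card {i. i \<le> length w \<and> P ((0 # w @ [0]) ! i) ((0 # w @ [0]) ! (i + 1))} =
    adj_count P (0 # w @ [0])"
  by (simp add: adj_count_eq_card less_Suc_eq_le)

lemma des_eq_adj_count: "des w = adj_count (\<lambda>x y. x > y) (0 # w @ [0])"
  using boundary_card_eq_adj_count[of w "\<lambda>x y. x > y"] by (simp add: des_def Let_def)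

lemma asc_eq_adj_count: "asc w = adj_count (<) (0 # w @ [0])"
  using boundary_card_eq_adj_count[of w "(<)"] by (simp add: asc_def Let_def)

lemma plat_eq_adj_count: "plat w = adj_count (=) (0 # w @ [0])"
  using boundary_card_eq_adj_count[of w "(=)"] by (simp add: plat_def Let_def)

text \<open>Repeating the first letter at the end turns the cyclic convention into ordinary
  adjacency.\<close>

lemma cyclic_card_eq_adj_count:
  "card {i. i < length (b # w) \<and> P ((b # w) ! i) ((b # w) ! ((i + 1) mod length (b # w)))} =
    adj_count P (b # w @ [b])"
proof -
  have "(b # w) ! ((i + 1) mod length (b # w)) = (b # w @ [b]) ! Suc i"
    "(b # w) ! i = (b # w @ [b]) ! i" if "i < length (b # w)" for i
    using that by (cases "i = length w"; auto simp: nth_append nth_Cons')+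
  then have "{i. i < length (b # w) \<and> P ((b # w) ! i) ((b # w) ! ((i + 1) mod length (b # w)))} =
      {i. Suc i < length (b # w @ [b]) \<and> P ((b # w @ [b]) ! i) ((b # w @ [b]) ! Suc i)}"
    by auto
  then show ?thesis by (simp add: adj_count_eq_card)
qed

lemma cdes_word_eq_adj_count: "cdes_word (b # w) = adj_count (\<lambda>x y. x > y) (b # w @ [b])"
  using cyclic_card_eq_adj_count[of b w "\<lambda>x y. x > y"] by (simp add: cdes_word_def)

lemma casc_word_eq_adj_count: "casc_word (b # w) = adj_count (<) (b # w @ [b])"
  using cyclic_card_eq_adj_count[of b w "(<)"] by (simp add: casc_word_def)

text \<open>Cutting at the copies that bound the gaps leaves the row of child labels and, for each
  gap, its inside framed by two copies. The row repeats a label along a run, and a leaf yields a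
  pair of equal letters; irreflexivity of \<open>P\<close> makes both count zero.\<close>

lemma adj_count_word:
  assumes "\<And>x. \<not> P x x" "clustered p cs" "p = None \<or> p = Some a"
  shows "adj_count P (a # word p cs @ [z]) =
    adj_count P (a # map fst cs @ [z]) +
    (\<Sum>(e, t)\<leftarrow>forest_edges cs. adj_count P (e # child_labels t @ [e]))"
  using assms(2,3)
proof (induction p cs arbitrary: a z rule: forest_induct2)
  case (Cons p e l cs r)
  have r: "adj_count P (e # word (Some e) r @ [z]) =
      adj_count P (e # map fst r @ [z]) +
      (\<Sum>(e, t)\<leftarrow>forest_edges r. adj_count P (e # child_labels t @ [e]))"
    using Cons.IH(2)[of e z] Cons.prems(1) by simp
  have cs: "adj_count P (e # word None cs @ [e]) =
      adj_count P (e # map fst cs @ [e]) +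
      (\<Sum>(e, t)\<leftarrow>forest_edges cs. adj_count P (e # child_labels t @ [e]))"
    using Cons.IH(1)[of e e] Cons.prems(1) by simp
  have app: "adj_count P (e # word None cs @ e # word (Some e) r @ [z]) =
      adj_count P (e # word None cs @ [e]) + adj_count P (e # word (Some e) r @ [z])"
    using adj_count_append[of P "e # word None cs" e "word (Some e) r @ [z]"] by simp
  show ?case
  proof (cases "p = Some e")
    case True
    then have "a = e" using Cons.prems by simp
    then show ?thesis
      using True Cons.prems(1) r cs app assms(1) by (cases l) simp_all
  next
    case False
    then show ?thesis
      using Cons.prems(1) r cs app assms(1) by (cases l) simp_all
  qed
qed simp_all

text \<open>Two copies are adjacent exactly when the gap between them is empty, that is, when its
  vertex is a leaf. The conditions on the framing letters \<open>a\<close> and \<open>z\<close>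
  exclude plateaus with the outside; the last summand is the surrounding gap itself when it is
  empty.\<close>

lemma adj_count_eq_word:
  assumes "clustered p cs" "z \<notin> forest_labels cs"
    and "p = Some a \<or> p = None \<and> a \<notin> forest_labels cs"
  shows "adj_count (=) (a # word p cs @ [z]) =
    length (filter (\<lambda>(e, t). children t = [] \<and> (\<exists>x. root_label t = IntL x)) (forest_edges cs)) +
    (if cs = [] \<and> a = z then 1 else 0)"
  using assms
proof (induction p cs arbitrary: a z rule: forest_induct2)
  case (Cons p e l cs r)
  let ?f = "\<lambda>cs. length (filter (\<lambda>(e, t). children t = [] \<and> (\<exists>x. root_label t = IntL x))
    (forest_edges cs))"
  have r: "adj_count (=) (e # word (Some e) r @ [z]) = ?f r"
    using Cons.IH(2)[of z e] Cons.prems by auto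
  have cs: "adj_count (=) (e # word None cs @ [e]) = ?f cs + (if cs = [] then 1 else 0)"
    using Cons.IH(1)[of e e] Cons.prems by auto
  have app: "adj_count (=) (e # word None cs @ e # word (Some e) r @ [z]) =
      adj_count (=) (e # word None cs @ [e]) + adj_count (=) (e # word (Some e) r @ [z])"
    using adj_count_append[of "(=)" "e # word None cs" e "word (Some e) r @ [z]"] by simp
  show ?case
  proof (cases "p = Some e")
    case True
    then have "a = e" using Cons.prems by simp
    then show ?thesis
      using True Cons.prems(1) r cs app by (cases l) simp_all
  next
    case False
    then have "a \<noteq> e" using Cons.prems by auto
    then show ?thesis
      using False Cons.prems(1) r cs app by (cases l) simp_all
  qed
qed auto

lemma vertices_from_Node:
  "vertices_from p (Node l cs) =
    (p, Node l cs) # map (\<lambda>(e, t). (Some e, t)) (forest_edges cs)"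
proof -
  have "concat (map (\<lambda>(e, t). vertices_from (Some e) t) cs) =
      map (\<lambda>(e, t). (Some e, t)) (forest_edges cs)"
    by (induction cs rule: forest_induct) auto
  then show ?thesis by simp
qed

declare vertices_from.simps [simp del]

lemma cdes_eq_des_word:
  assumes "clustered None cs"
  shows "cdes (Node l cs) = des (word None cs)"
proof -
  have "cdes (Node l cs) = des (map fst cs) +
      (\<Sum>(e, t)\<leftarrow>forest_edges cs. cdes_word (e # child_labels t))"
    by (auto simp: cdes_def vertices_from_Node intro!: arg_cong[of _ _ sum_list] map_cong)
  \<comment> \<open>At the root the two boundary zeros take the place of the two copies of the edge
    label.\<close>
  then show ?thesis
    using adj_count_word[OF _ assms, of "\<lambda>x y. x > y" 0 0]
    by (simp add: des_eq_adj_count cdes_word_eq_adj_count)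
qed

lemma casc_eq_asc_word:
  assumes "clustered None cs"
  shows "casc (Node l cs) = asc (word None cs)"
proof -
  have "casc (Node l cs) = asc (map fst cs) +
      (\<Sum>(e, t)\<leftarrow>forest_edges cs. casc_word (e # child_labels t))"
    by (auto simp: casc_def vertices_from_Node intro!: arg_cong[of _ _ sum_list] map_cong)
  then show ?thesis
    using adj_count_word[OF _ assms, of "(<)" 0 0]
    by (simp add: asc_eq_adj_count casc_word_eq_adj_count)
qed

text \<open>With non-zero letters the boundary zeros form a plateau only around the empty word,
  which is the case where the root is a leaf.\<close>

lemma leaf_star_eq_plat_word:
  assumes "clustered None cs" "0 \<notin> forest_labels cs"
  shows "leaf_star (Node (IntL r) cs) = plat (word None cs)"
proof -
  have "leaf_star (Node (IntL r) cs) =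
      length (filter (\<lambda>(e, t). children t = [] \<and> (\<exists>x. root_label t = IntL x)) (forest_edges cs)) +
      (if cs = [] then 1 else 0)"
    by (simp add: leaf_star_def vertices_from_Node filter_map o_def case_prod_unfold)
  then show ?thesis
    using adj_count_eq_word[OF assms, of 0] assms by (simp add: plat_eq_adj_count)
qed

section \<open>Clustered forests\<close>

lemma subset_forest_edges: "set cs \<subseteq> set (forest_edges cs)"
  by (induction cs rule: forest_induct) auto

text \<open>Every edge is either at the top or a child edge of exactly one vertex. The two lists
  differ in order, hence the multisets.\<close>

lemma mset_children_forest_edges:
  "mset (cs @ concat (map (\<lambda>(e, t). children t) (forest_edges cs))) = mset (forest_edges cs)"
proof (induction cs rule: forest_induct)
  case (Cons e l cs r)
  let ?c = "\<lambda>cs. mset (concat (map (\<lambda>(e, t). children t) (forest_edges cs)))"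
  have "mset (((e, Node l cs) # r) @
      concat (map (\<lambda>(e, t). children t) (forest_edges ((e, Node l cs) # r)))) =
    add_mset (e, Node l cs) ((mset cs + ?c cs) + (mset r + ?c r))"
    by (simp add: ac_simps)
  also have "\<dots> = mset (forest_edges ((e, Node l cs) # r))"
    using Cons by simp
  finally show ?case .
qed simp

lemma set_forest_edges:
  "set (forest_edges cs) = set cs \<union> (\<Union>t\<in>snd ` set (forest_edges cs). set (children t))"
proof -
  have "set (forest_edges cs) =
      set (cs @ concat (map (\<lambda>(e, t). children t) (forest_edges cs)))"
    using mset_children_forest_edges[THEN mset_eq_setD] by (rule sym)
  then show ?thesis by (simp add: case_prod_unfold)
qed

lemma forest_labels_eq:
  "forest_labels cs =
    fst ` set cs \<union> (\<Union>t\<in>snd ` set (forest_edges cs). fst ` set (children t))"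
  using arg_cong[OF set_forest_edges, of "image fst"] by (simp add: image_Un image_UN)

lemma child_labels_subset:
  "t \<in> snd ` set (forest_edges cs) \<Longrightarrow> fst ` set (children t) \<subseteq> forest_labels cs"
  by (subst forest_labels_eq) auto

lemma clustered_hd:
  assumes "clustered (Some e) cs" "e \<in> forest_labels cs"
  shows "e \<in> fst ` set cs" "fst (hd cs) = e" "cs \<noteq> []"
  using assms by (induction cs rule: forest_induct) auto

lemma clustered_children:
  "clustered p cs \<Longrightarrow> t \<in> snd ` set (forest_edges cs) \<Longrightarrow> clustered None (children t)"
proof (induction p cs rule: forest_induct2)
  case (Cons p e l cs r)
  have "t = Node l cs \<or> t \<in> snd ` set (forest_edges cs) \<or> t \<in> snd ` set (forest_edges r)"
    using Cons.prems(2) by auto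
  then show ?case using Cons.IH Cons.prems(1) by (elim disjE) simp_all
qed simp

lemma clustered_SymL:
  "clustered p cs \<Longrightarrow> (e, t) \<in> set (forest_edges cs) \<Longrightarrow> root_label t = SymL i \<Longrightarrow>
    i = e \<and> children t = []"
proof (induction p cs rule: forest_induct2)
  case (Cons p x l cs r)
  have "e = x \<and> t = Node l cs \<or> (e, t) \<in> set (forest_edges cs) \<or> (e, t) \<in> set (forest_edges r)"
    using Cons.prems(2) by auto
  then show ?case using Cons.IH Cons.prems(1,3) by (elim disjE) simp_all
qed simp

lemma disjoint_mono: "A \<inter> B = {} \<Longrightarrow> C \<subseteq> A \<Longrightarrow> D \<subseteq> B \<Longrightarrow> C \<inter> D = {}"
  by blast

lemma clustered_disjoint_child_labels:
  "clustered p cs \<Longrightarrow> t \<in> snd ` set (forest_edges cs) \<Longrightarrow>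
    fst ` set cs \<inter> fst ` set (children t) = {}"
proof (induction p cs rule: forest_induct2)
  case (Cons p e l cs r)
  have cl: "e \<notin> forest_labels cs" "forest_labels cs \<inter> forest_labels r = {}"
    "clustered None cs" "clustered (Some e) r"
    using Cons.prems(1) by auto
  have top: "fst ` set cs \<subseteq> forest_labels cs" "fst ` set r \<subseteq> forest_labels r"
    using subset_forest_edges by blast+
  have labels: "fst ` set ((e, Node l cs) # r) = insert e (fst ` set r)" by simp
  consider "fst ` set (children t) \<subseteq> forest_labels cs" | "t \<in> snd ` set (forest_edges r)"
  proof -
    have "t = Node l cs \<or> t \<in> snd ` set (forest_edges cs) \<or> t \<in> snd ` set (forest_edges r)"
      using Cons.prems(2) by auto
    then show thesis
    proof (elim disjE)
      assume "t = Node l cs"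
      then show thesis using that(1) top(1) by simp
    qed (use that child_labels_subset in blast)+
  qed
  then show ?case
  proof cases
    case 1
    have "e \<notin> fst ` set (children t)" using 1 cl(1) by (rule contra_subsetD)
    moreover have "fst ` set r \<inter> fst ` set (children t) = {}"
      using disjoint_mono[OF cl(2) 1 top(2)] by (subst Int_commute)
    ultimately show ?thesis unfolding labels by simp
  next
    case 2
    note r = Cons.IH(2)[OF cl(4) 2]
    have "e \<notin> fst ` set (children t)"
    proof
      assume *: "e \<in> fst ` set (children t)"
      \<comment> \<open>If \<open>e\<close> recurs to the right, it does so at the head of
        \<open>r\<close>, and top labels of \<open>r\<close> fall under the induction
        hypothesis.\<close>
      then have "e \<in> fst ` set r"
        using clustered_hd(1)[OF cl(4)] child_labels_subset[OF 2] by (meson subsetD)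
      then show False using r * by (meson disjoint_iff)
    qed
    then show ?thesis unfolding labels using r by simp
  qed
qed auto

text \<open>Vertices on the two sides of the induction step see disjoint sets of labels; the vertex
  of the first edge is compared with those below it by the preceding disjointness of child
  labels.\<close>

lemma clustered_parent_unique:
  assumes "clustered p cs" "t \<in> snd ` set (forest_edges cs)" "u \<in> snd ` set (forest_edges cs)"
    and "fst ` set (children t) \<inter> fst ` set (children u) \<noteq> {}"
  shows "t = u"
  using assms
proof (induction p cs rule: forest_induct2)
  case (Cons p e l cs r)
  have cl: "forest_labels cs \<inter> forest_labels r = {}"
    "clustered None cs" "clustered (Some e) r"
    using Cons.prems(1) by auto
  have top: "fst ` set cs \<subseteq> forest_labels cs"
    using subset_forest_edges by blast
  let ?L = "insert (Node l cs) (snd ` set (forest_edges cs))" and ?R = "snd ` set (forest_edges r)"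
  have L: "fst ` set (children v) \<subseteq> forest_labels cs" if "v \<in> ?L" for v
    using that
    by (rule insertE) (use child_labels_subset[of v cs] top in simp_all)
  have R: "fst ` set (children v) \<subseteq> forest_labels r" if "v \<in> ?R" for v
    using that by (rule child_labels_subset)
  have "t \<in> ?L \<union> ?R" "u \<in> ?L \<union> ?R"
    using Cons.prems(2,3) by auto
  moreover have "\<not> (t \<in> ?L \<and> u \<in> ?R)" "\<not> (t \<in> ?R \<and> u \<in> ?L)"
    using disjoint_mono[OF cl(1) L R] Cons.prems(4) by (metis Int_commute)+
  ultimately consider "t \<in> ?L" "u \<in> ?L" | "t \<in> ?R" "u \<in> ?R"
    by blast
  then show ?case
  proof cases
    case 1
    have "fst ` set (children (Node l cs)) \<inter> fst ` set (children v) = {}"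
      if "v \<in> snd ` set (forest_edges cs)" for v
      using clustered_disjoint_child_labels[OF cl(2) that] by simp
    then show ?thesis
      using 1 Cons.IH(1)[OF cl(2)] Cons.prems(4) by blast
  next
    case 2
    then show ?thesis using Cons.IH(2)[OF cl(3)] Cons.prems(4) by blast
  qed
qed auto

section \<open>From conditions on all vertices to clustered forests\<close>

definition contiguous :: "'a list \<Rightarrow> bool" where
  "contiguous xs \<longleftrightarrow>
    (\<forall>i j k. i < j \<and> j < k \<and> k < length xs \<and> xs ! i = xs ! k \<longrightarrow> xs ! j = xs ! i)"

lemma contiguousD:
  "contiguous xs \<Longrightarrow> i < j \<Longrightarrow> j < k \<Longrightarrow> k < length xs \<Longrightarrow> xs ! i = xs ! k \<Longrightarrow>
    xs ! j = xs ! i"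
  unfolding contiguous_def by blast

text \<open>An inductive form of the index condition, matching how \<open>clustered\<close> lets a
  label recur only at the head.\<close>

lemma contiguous_Cons:
  "contiguous (x # xs) \<longleftrightarrow> contiguous xs \<and> (x \<in> set xs \<longrightarrow> hd xs = x)"
proof
  assume *: "contiguous (x # xs)"
  have "contiguous xs"
    unfolding contiguous_def
  proof (intro allI impI)
    fix i j k assume "i < j \<and> j < k \<and> k < length xs \<and> xs ! i = xs ! k"
    then show "xs ! j = xs ! i"
      using *[unfolded contiguous_def, rule_format, of "Suc i" "Suc j" "Suc k"] by simp
  qed
  moreover have "hd xs = x" if x: "x \<in> set xs"
  proof -
    obtain k where k: "k < length xs" "xs ! k = x"
      using x by (auto simp: in_set_conv_nth)
    moreover have "hd xs = xs ! 0"
      using x by (intro hd_conv_nth) auto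
    ultimately show ?thesis
      using *[unfolded contiguous_def, rule_format, of 0 "Suc 0" "Suc k"]
      by (cases k) auto
  qed
  ultimately show "contiguous xs \<and> (x \<in> set xs \<longrightarrow> hd xs = x)" by blast
next
  assume *: "contiguous xs \<and> (x \<in> set xs \<longrightarrow> hd xs = x)"
  show "contiguous (x # xs)"
    unfolding contiguous_def
  proof (intro allI impI)
    fix i j k
    assume ijk: "i < j \<and> j < k \<and> k < length (x # xs) \<and> (x # xs) ! i = (x # xs) ! k"
    then obtain j' k' where jk: "j = Suc j'" "k = Suc k'"
      by (cases j; cases k) auto
    show "(x # xs) ! j = (x # xs) ! i"
    proof (cases i)
      case (Suc i')
      then show ?thesis
        using contiguousD[of xs i' j' k'] * ijk jk by simp
    next
      case 0
      then have k': "xs ! k' = x" "k' < length xs" "j' < k'" using ijk jk by simp_all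
      then have "x \<in> set xs" using nth_mem by metis
      then have "xs ! 0 = x" using * hd_conv_nth[of xs] by force
      moreover have "xs ! j' = xs ! 0"
        using contiguousD[of xs 0 j' k'] * k' \<open>xs ! 0 = x\<close> by (cases "j' = 0") simp_all
      ultimately show ?thesis using 0 jk by simp
    qed
  qed
qed

lemma clustered_contiguous: "clustered p cs \<Longrightarrow> contiguous (map fst cs)"
proof (induction p cs rule: forest_induct2)
  case (Nil p)
  then show ?case by (simp add: contiguous_def)
next
  case (Cons p e l cs r)
  have "e \<in> forest_labels r" if "e \<in> fst ` set r"
    using that subset_forest_edges by blast
  then show ?case
    using Cons clustered_hd[of e r] by (auto simp: contiguous_Cons hd_map)
qed

text \<open>The label in \<open>p\<close> is treated as one more top label on the left, so that the
  hypotheses pass on to the siblings on the right. Distinct subtrees let equality of subtrees stand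
  for equality of vertices.\<close>

lemma clusteredI:
  assumes "distinct (map snd (forest_edges cs))"
    and "\<And>t u. t \<in> snd ` set (forest_edges cs) \<Longrightarrow> u \<in> snd ` set (forest_edges cs) \<Longrightarrow>
      fst ` set (children t) \<inter> fst ` set (children u) \<noteq> {} \<Longrightarrow> t = u"
    and "\<And>t. t \<in> snd ` set (forest_edges cs) \<Longrightarrow>
      (set_option p \<union> fst ` set cs) \<inter> fst ` set (children t) = {}"
    and "\<And>t. t \<in> snd ` set (forest_edges cs) \<Longrightarrow> contiguous (child_labels t)"
    and "contiguous ((case p of None \<Rightarrow> [] | Some k \<Rightarrow> [k]) @ map fst cs)"
    and "\<And>e t i. (e, t) \<in> set (forest_edges cs) \<Longrightarrow> root_label t = SymL i \<Longrightarrow>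
      i = e \<and> children t = [] \<and> p \<noteq> Some e \<and> (\<forall>u. (e, u) \<in> set (forest_edges cs) \<longrightarrow> u = t)"
  shows "clustered p cs"
  using assms
proof (induction p cs rule: forest_induct2)
  case (Cons p e l cs r)
  define N where "N = Node l cs"
  define L where "L = snd ` set (forest_edges cs)"
  define R where "R = snd ` set (forest_edges r)"
  define C where "C t = fst ` set (children t)" for t
  have all: "snd ` set (forest_edges ((e, Node l cs) # r)) = insert N (L \<union> R)"
    by (simp add: N_def L_def R_def image_Un)
  have dist: "N \<notin> L" "N \<notin> R" "L \<inter> R = {}"
    "distinct (map snd (forest_edges cs))" "distinct (map snd (forest_edges r))"
    using Cons.prems(1) by (auto simp: N_def L_def R_def)
  have par: "t = u" if "t \<in> insert N (L \<union> R)" "u \<in> insert N (L \<union> R)" "C t \<inter> C u \<noteq> {}" for t u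
    using Cons.prems(2)[unfolded all, folded C_def] that by blast
  have top: "(set_option p \<union> insert e (fst ` set r)) \<inter> C t = {}" if "t \<in> insert N (L \<union> R)" for t
    using Cons.prems(3)[unfolded all, folded C_def, OF that] by simp
  have contig: "contiguous (child_labels t)" if "t \<in> insert N (L \<union> R)" for t
    by (rule Cons.prems(4)) (use that all in simp)
  have labels_cs: "forest_labels cs = (\<Union>t\<in>insert N L. C t)"
    by (subst forest_labels_eq) (simp add: C_def N_def L_def)
  have labels_r: "forest_labels r = fst ` set r \<union> (\<Union>t\<in>R. C t)"
    by (subst forest_labels_eq) (simp add: C_def R_def)
  have contig_er: "contiguous (e # map fst r)"
    using Cons.prems(5) by (cases p) (simp_all add: contiguous_Cons)
  have 1: "e \<notin> forest_labels cs"
    unfolding labels_cs using top by blast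
  \<comment> \<open>A common label has a parent in \<open>insert N L\<close>. It cannot also be a
    top label of \<open>r\<close>, and a second parent in \<open>R\<close> would be a different
    subtree.\<close>
  have 2: "forest_labels cs \<inter> forest_labels r = {}"
    unfolding labels_cs labels_r
  proof (rule ccontr)
    assume "(\<Union>t\<in>insert N L. C t) \<inter> (fst ` set r \<union> (\<Union>t\<in>R. C t)) \<noteq> {}"
    then obtain x where "x \<in> (\<Union>t\<in>insert N L. C t)" and x: "x \<in> fst ` set r \<union> (\<Union>t\<in>R. C t)"
      by (meson disjoint_iff)
    then obtain t where t: "t \<in> insert N L" "x \<in> C t"
      by (meson UN_E)
    then have "x \<notin> fst ` set r" using top[of t] by blast
    then obtain u where u: "u \<in> R" "x \<in> C u"
      using x by blast
    then have "t = u" using t par[of t u] by blast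
    then show False using t u dist by blast
  qed
  have 3: "k \<notin> forest_labels cs \<union> forest_labels r" if p: "p = Some k" "k \<noteq> e" for k
  proof -
    have "k \<notin> set (map fst r)"
      using Cons.prems(5) p by (simp add: contiguous_Cons)
    moreover have "k \<notin> C t" if "t \<in> insert N (L \<union> R)" for t
      using top[OF that] p by auto
    ultimately show ?thesis unfolding labels_cs labels_r by auto
  qed
  have sym: "i = x \<and> children t = [] \<and> p \<noteq> Some x \<and>
      (\<forall>u. (x, u) \<in> set (forest_edges ((e, Node l cs) # r)) \<longrightarrow> u = t)"
    if "(x, t) \<in> set (forest_edges ((e, Node l cs) # r))" "root_label t = SymL i" for x t i
    using Cons.prems(6)[OF that] by blast
  have 4: "i = e \<and> cs = [] \<and> p \<noteq> Some e \<and> e \<notin> forest_labels r" if "l = SymL i" for i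
  proof -
    have s: "i = e \<and> cs = [] \<and> p \<noteq> Some e"
      "\<And>u. (e, u) \<in> set (forest_edges r) \<Longrightarrow> u = N"
      using sym[of e "Node l cs" i] that by (auto simp: N_def)
    have "e \<notin> forest_labels r"
    proof
      assume "e \<in> forest_labels r"
      then obtain u where u: "(e, u) \<in> set (forest_edges r)" by auto
      then have "u \<in> R" by (simp add: R_def rev_image_eqI)
      then show False using s(2)[OF u] dist by simp
    qed
    then show ?thesis using s(1) by simp
  qed
  have 5: "clustered None cs"
  proof (rule Cons.IH(1), fold L_def C_def, goal_cases)
    case 1
    then show ?case using dist by simp
  next
    case (2 t u)
    then show ?case using par by blast
  next
    case (3 t)
    have "N \<noteq> t" using 3 dist by blast
    then have "C N \<inter> C t = {}" using par[of N t] 3 by blast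
    then show ?case by (simp add: C_def N_def)
  next
    case (4 t)
    then show ?case using contig by blast
  next
    case 5
    then show ?case using contig[of N] by (simp add: N_def)
  next
    case (6 x t i)
    then have "(x, t) \<in> set (forest_edges ((e, Node l cs) # r))" by simp
    from sym[OF this 6(2)] show ?case by simp
  qed
  have 6: "clustered (Some e) r"
  proof (rule Cons.IH(2), fold R_def C_def, goal_cases)
    case 1
    then show ?case using dist by simp
  next
    case (2 t u)
    then show ?case using par by blast
  next
    case (3 t)
    then show ?case using top[of t] by auto
  next
    case (4 t)
    then show ?case using contig by blast
  next
    case 5
    then show ?case using contig_er by simp
  next
    case (6 x t i)
    then have "t \<in> R" by (simp add: R_def rev_image_eqI)
    then have "t \<noteq> N" using dist by blast
    have "(x, t) \<in> set (forest_edges ((e, Node l cs) # r))" using 6 by simp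
    from sym[OF this 6(2)] have *: "i = x" "children t = []"
      "\<And>u. (x, u) \<in> set (forest_edges ((e, Node l cs) # r)) \<Longrightarrow> u = t" by blast+
    \<comment> \<open>If \<open>e = x\<close>, the first edge would be a second
      \<open>x\<close>-edge beside the one above the symbol.\<close>
    have "e \<noteq> x" using *(3)[of N] \<open>t \<noteq> N\<close> by (auto simp: N_def)
    then show ?case using * by simp
  qed
  show ?case unfolding clustered.simps using 1 2 3 4 5 6 by blast
qed simp

section \<open>Order of the vertex labels below equal edges\<close>

lemma sorted_wrt_forest_edgesD:
  assumes "sorted_wrt Q (forest_edges cs)"
  shows "sorted_wrt Q cs" "t \<in> snd ` set (forest_edges cs) \<Longrightarrow> sorted_wrt Q (children t)"
  using assms
proof (induction cs rule: forest_induct)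
  case (Cons e l cs r)
  case 1
  then show ?case using Cons.IH(3) subset_forest_edges[of r] by (auto simp: sorted_wrt_append)
  case 2
  then show ?case using Cons.IH by (auto simp: sorted_wrt_append)
qed auto

text \<open>In a clustered forest edges with equal labels are siblings, so a comparison across the
  whole forest reduces to one vertex at a time.\<close>

lemma sorted_wrt_forest_edgesI:
  assumes "clustered p cs" "sorted_wrt (\<lambda>a b. fst a = fst b \<longrightarrow> Q a b) cs"
    and "\<And>t. t \<in> snd ` set (forest_edges cs) \<Longrightarrow>
      sorted_wrt (\<lambda>a b. fst a = fst b \<longrightarrow> Q a b) (children t)"
  shows "sorted_wrt (\<lambda>a b. fst a = fst b \<longrightarrow> Q a b) (forest_edges cs)"
  using assms
proof (induction p cs rule: forest_induct2)
  case (Cons p e l cs r)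
  have cl: "e \<notin> forest_labels cs" "forest_labels cs \<inter> forest_labels r = {}"
    "clustered None cs" "clustered (Some e) r"
    using Cons.prems(1) by auto
  have below: "sorted_wrt (\<lambda>a b. fst a = fst b \<longrightarrow> Q a b) (children t)"
    if "t = Node l cs \<or> t \<in> snd ` set (forest_edges cs) \<or> t \<in> snd ` set (forest_edges r)" for t
    by (rule Cons.prems(3)) (use that in auto)
  have top: "(e, t) \<in> set r" if t: "(e, t) \<in> set (forest_edges r)" for t
  proof (rule ccontr)
    assume "(e, t) \<notin> set r"
    then obtain u where "u \<in> snd ` set (forest_edges r)" "(e, t) \<in> set (children u)"
      using t set_forest_edges[of r] by blast
    moreover have "e \<in> fst ` set r"
      using clustered_hd(1)[OF cl(4)] t by force
    ultimately show False
      using clustered_disjoint_child_labels[OF cl(4), of u] by force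
  qed
  have "sorted_wrt (\<lambda>a b. fst a = fst b \<longrightarrow> Q a b) (forest_edges cs)"
    by (rule Cons.IH(1)[OF cl(3)]) (use below below[of "Node l cs"] in simp_all)
  moreover have "sorted_wrt (\<lambda>a b. fst a = fst b \<longrightarrow> Q a b) (forest_edges r)"
    by (rule Cons.IH(2)[OF cl(4)]) (use below Cons.prems(2) in simp_all)
  moreover have "\<forall>a\<in>set (forest_edges cs). \<forall>b\<in>set (forest_edges r). fst a \<noteq> fst b"
    using cl(2) by blast
  moreover have "\<forall>a\<in>set (forest_edges cs). e \<noteq> fst a"
    using cl(1) by blast
  moreover have "\<forall>b\<in>set (forest_edges r). e = fst b \<longrightarrow> Q (e, Node l cs) b"
    using top Cons.prems(2) by auto
  ultimately show ?case by (simp add: sorted_wrt_append ball_Un)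
qed simp

lemma sorted_wrt_key_iff:
  "sorted_wrt (\<lambda>a b. f a = f b \<longrightarrow> Q a b) xs \<longleftrightarrow>
    (\<forall>e. sorted_wrt Q (filter (\<lambda>x. f x = e) xs))"
  by (induction xs) (auto simp: eq_commute)

section \<open>The trees of a multiset\<close>

definition slice :: "(nat \<Rightarrow> nat) \<Rightarrow> 'a list \<Rightarrow> nat \<Rightarrow> 'a list" where
  "slice len xs e = take (len e) (drop (\<Sum>i=1..<e. len i) xs)"

lemma concat_slice:
  assumes "(\<Sum>i=1..<Suc n. len i) = length xs"
  shows "concat (map (slice len xs) [1..<Suc n]) = xs"
proof -
  have "concat (map (slice len xs) [1..<Suc k]) = take (\<Sum>i=1..<Suc k. len i) xs" for k
    by (induction k) (simp_all add: slice_def take_add)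
  then show ?thesis using assms by simp
qed

lemma length_slice:
  assumes "(\<Sum>i=1..<Suc n. len i) = length xs" "e \<in> {1..n}"
  shows "length (slice len xs e) = len e"
proof -
  have "(\<Sum>i=1..<e. len i) + len e = (\<Sum>i=1..<Suc e. len i)"
    using assms(2) by simp
  also have "\<dots> \<le> (\<Sum>i=1..<Suc n. len i)"
    by (rule sum_mono2) (use assms(2) in auto)
  finally show ?thesis using assms(1) by (simp add: slice_def)
qed

text \<open>Identifies the label blocks of a given tree with the slots, once both are known to
  concatenate to the same list.\<close>

lemma concat_map_inj:
  assumes "concat (map f es) = concat (map g es)" "\<And>e. e \<in> set es \<Longrightarrow> length (f e) = length (g e)"
    and "e \<in> set es"
  shows "f e = g e"
  using assms by (induction es) auto

lemma sorted_wrt_concat_map: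
  "sorted_wrt Q (concat (map f es)) \<longleftrightarrow>
    (\<forall>e\<in>set es. sorted_wrt Q (f e)) \<and>
    sorted_wrt (\<lambda>e1 e2. \<forall>x\<in>set (f e1). \<forall>y\<in>set (f e2). Q x y) es"
  by (induction es) (auto simp: sorted_wrt_append)

lemma sorted_wrt_upt_iff:
  "sorted_wrt Q [a..<b] \<longleftrightarrow> (\<forall>i j. a \<le> i \<longrightarrow> i < j \<longrightarrow> j < b \<longrightarrow> Q i j)"
  by (induction b) (auto simp: sorted_wrt_append less_Suc_eq)

lemma count_multi: "count (multi n m) x = (if x \<in> {1..n} then m x else 0)"
  by (simp add: multi_def count_sum if_distrib sum.delta cong: if_cong)

lemma size_multi: "size (multi n m) = (\<Sum>i=1..n. m i)"
  by (simp add: multi_def)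

lemma finite_multiples [simp]: "finite (multiples n m)"
  and finite_singles [simp]: "finite (singles n m)"
  by (simp_all add: multiples_def singles_def)

lemma singles_disjoint_multiples: "e \<in> singles n m \<Longrightarrow> e \<notin> multiples n m"
  by (simp add: singles_def multiples_def)

lemma mset_set_multiples_subset: "mset_set (multiples n m) \<subseteq># multi n m"
  by (rule mset_subset_eqI) (auto simp: count_mset_set' count_multi multiples_def)

lemma set_labels_at: "l \<in> set (labels_at e cs) \<longleftrightarrow> (\<exists>t. (e, t) \<in> set (forest_edges cs) \<and> root_label t = l)"
  by (force simp: labels_at_def)

lemma count_forest_labels: "count (mset (map fst (forest_edges cs))) e = length (labels_at e cs)"
proof -
  have "count (mset (map f xs)) e = length (filter (\<lambda>x. f x = e) xs)" for f :: "'b \<Rightarrow> 'c" and xs e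
    by (induction xs) auto
  then show ?thesis by (simp add: labels_at_def)
qed

lemma mset_edges: "mset (edges (Node l cs)) = mset (forest_edges cs)"
proof -
  have "edges (Node l cs) = cs @ concat (map (\<lambda>(e, t). children t) (forest_edges cs))"
    by (simp add: edges_def vertices_from_Node o_def case_prod_unfold)
  then show ?thesis by (simp only: mset_children_forest_edges)
qed

definition sibling_increasing :: "nat \<times> vetree \<Rightarrow> nat \<times> vetree \<Rightarrow> bool" where
  "sibling_increasing a b \<longleftrightarrow>
    (\<exists>x y. root_label (snd a) = IntL x \<and> root_label (snd b) = IntL y \<and> x < y)"

text \<open>The defining conditions with the root split off and the index conditions replaced by
  \<open>contiguous\<close> and \<open>sorted_wrt\<close>, the forms that the lemmas on forests
  supply and consume.\<close>

lemma ve_trees_Node_iff: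
  defines "F \<equiv> forest_edges"
  shows "Node l cs \<in> ve_trees n m \<longleftrightarrow>
    length (F cs) = size (multi n m) - card (multiples n m) \<and>
    distinct (l # map (root_label \<circ> snd) (F cs)) \<and>
    insert l ((root_label \<circ> snd) ` set (F cs)) =
      IntL ` {0..size (multi n m) - n} \<union> SymL ` singles n m \<and>
    (\<forall>i\<in>singles n m. l \<noteq> SymL i) \<and>
    (\<forall>(e, t)\<in>set (F cs). \<forall>i\<in>singles n m. root_label t = SymL i \<longleftrightarrow> children t = [] \<and> e = i) \<and>
    mset (map fst (F cs)) = multi n m - mset_set (multiples n m) \<and>
    (\<forall>t\<in>insert (Node l cs) (snd ` set (F cs)). \<forall>u\<in>insert (Node l cs) (snd ` set (F cs)).
      fst ` set (children t) \<inter> fst ` set (children u) \<noteq> {} \<longrightarrow> t = u) \<and>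
    (\<forall>t\<in>insert (Node l cs) (snd ` set (F cs)). contiguous (child_labels t)) \<and>
    (\<forall>t\<in>insert (Node l cs) (snd ` set (F cs)).
      sorted_wrt (\<lambda>a b. fst a = fst b \<longrightarrow> sibling_increasing a b) (children t)) \<and>
    (\<forall>a\<in>set (F cs). \<forall>b\<in>set (F cs). \<forall>x y.
      fst a \<noteq> fst b \<and> root_label (snd a) = IntL x \<and> root_label (snd b) = IntL y \<longrightarrow>
      (fst a < fst b \<longleftrightarrow> x < y))"
proof -
  let ?T = "Node l cs" and ?V = "insert (Node l cs) (snd ` set (F cs))"
  have len: "length (edges ?T) = length (F cs)"
    unfolding F_def using mset_edges by (metis size_mset)
  have set: "set (edges ?T) = set (F cs)"
    unfolding F_def using mset_edges by (metis set_mset_mset)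
  have mset: "mset (map fst (edges ?T)) = mset (map fst (F cs))"
    unfolding F_def using mset_edges by (metis mset_map)
  have verts: "vertices ?T = (None, ?T) # map (\<lambda>(e, t). (Some e, t)) (F cs)"
    by (simp add: vertices_from_Node F_def)
  have ball: "(\<forall>(p, t)\<in>set (vertices ?T). P t) \<longleftrightarrow> (\<forall>t\<in>?V. P t)" for P
    by (simp add: verts case_prod_unfold)
  have vlabels: "vertex_labels_ok n m ?T \<longleftrightarrow>
      distinct (l # map (root_label \<circ> snd) (F cs)) \<and>
      insert l ((root_label \<circ> snd) ` set (F cs)) =
        IntL ` {0..size (multi n m) - n} \<union> SymL ` singles n m"
    by (simp add: vertex_labels_ok_def verts Let_def o_def case_prod_unfold image_image)
  have syms: "symbols_ok n m ?T \<longleftrightarrow> (\<forall>i\<in>singles n m. l \<noteq> SymL i) \<and>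
      (\<forall>(e, t)\<in>set (F cs). \<forall>i\<in>singles n m. root_label t = SymL i \<longleftrightarrow> children t = [] \<and> e = i)"
    by (simp add: symbols_ok_def verts case_prod_unfold)
  have elabels: "edge_labels_ok n m ?T \<longleftrightarrow>
      mset (map fst (F cs)) = multi n m - mset_set (multiples n m) \<and>
      (\<forall>t\<in>?V. \<forall>u\<in>?V. fst ` set (children t) \<inter> fst ` set (children u) \<noteq> {} \<longrightarrow> t = u) \<and>
      (\<forall>t\<in>?V. contiguous (child_labels t))"
    unfolding edge_labels_ok_def mset ball contiguous_def by simp
  have compat: "compatible ?T \<longleftrightarrow>
      (\<forall>t\<in>?V. sorted_wrt (\<lambda>a b. fst a = fst b \<longrightarrow> sibling_increasing a b) (children t)) \<and>
      (\<forall>a\<in>set (F cs). \<forall>b\<in>set (F cs). \<forall>x y.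
        fst a \<noteq> fst b \<and> root_label (snd a) = IntL x \<and> root_label (snd b) = IntL y \<longrightarrow>
        (fst a < fst b \<longleftrightarrow> x < y))"
  proof -
    have "(\<forall>i j. i < j \<and> j < length (children t) \<and> child_labels t ! i = child_labels t ! j \<longrightarrow>
        (\<exists>x y. root_label (snd (children t ! i)) = IntL x \<and>
               root_label (snd (children t ! j)) = IntL y \<and> x < y)) \<longleftrightarrow>
        sorted_wrt (\<lambda>a b. fst a = fst b \<longrightarrow> sibling_increasing a b) (children t)" for t
      unfolding sorted_wrt_iff_nth_less sibling_increasing_def by (auto; metis less_trans nth_map)
    then show ?thesis
      unfolding compatible_def set ball by (simp only: case_prod_unfold)
  qed
  show ?thesis
    unfolding ve_trees_def using len vlabels syms elabels compat by simp
qed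

section \<open>The vertex labels forced by compatibility\<close>

locale multiplicities =
  fixes n :: nat and m :: "nat \<Rightarrow> nat"
  assumes m_ge_1: "\<And>i. i \<in> {1..n} \<Longrightarrow> m i \<ge> 1"
begin

text \<open>The total number of gaps: the integer labels run from \<open>0\<close> to
  \<open>excess\<close>, one for each gap and one for the root.\<close>

definition excess :: nat where
  "excess = size (multi n m) - n"

text \<open>The integers that compatibility forces on the vertices below the \<open>e\<close>-edges when the root has
  the label \<open>r\<close>: cut the increasing list of the other integers into blocks of lengths \<open>m i - 1\<close>.\<close>

definition slots :: "nat \<Rightarrow> nat \<Rightarrow> nat list" where
  "slots r = slice (\<lambda>i. m i - 1) (sorted_list_of_set ({0..excess} - {r}))"

definition canonical_labels :: "nat \<Rightarrow> nat \<Rightarrow> vlabel list" where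
  "canonical_labels r e =
    (if e \<in> singles n m then [SymL e]
     else if e \<in> multiples n m then map IntL (slots r e) else [])"

text \<open>For \<open>e\<close> outside \<open>{1..n}\<close> the equation says that no edge is
  labeled \<open>e\<close>.\<close>

definition canonical :: "nat \<Rightarrow> forest \<Rightarrow> bool" where
  "canonical r cs \<longleftrightarrow> clustered None cs \<and> (\<forall>e. labels_at e cs = canonical_labels r e)"

lemma excess_eq: "excess = (\<Sum>i=1..n. m i - 1)"
  and size_multi_eq: "size (multi n m) = excess + n"
proof -
  \<comment> \<open>Truncated subtraction is exact here because every \<open>m i\<close> is at least
    1.\<close>
  have "size (multi n m) = (\<Sum>i=1..n. (m i - 1) + 1)"
    unfolding size_multi by (intro sum.cong refl) (use m_ge_1 in fastforce)
  also have "\<dots> = (\<Sum>i=1..n. m i - 1) + n"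
    by (simp only: sum.distrib) simp
  finally show "excess = (\<Sum>i=1..n. m i - 1)" "size (multi n m) = excess + n"
    by (simp_all add: excess_def)
qed

lemma singles_or_multiples: "e \<in> {1..n} \<longleftrightarrow> e \<in> singles n m \<or> e \<in> multiples n m"
  using m_ge_1[of e] by (auto simp: singles_def multiples_def)

lemma card_singles_multiples: "card (singles n m) + card (multiples n m) = n"
proof -
  have "card (singles n m \<union> multiples n m) = card (singles n m) + card (multiples n m)"
    by (rule card_Un_disjoint) (auto simp: singles_disjoint_multiples)
  moreover have "singles n m \<union> multiples n m = {1..n}"
    using singles_or_multiples by blast
  ultimately show ?thesis by simp
qed

lemma number_of_edges: "size (multi n m) - card (multiples n m) = excess + card (singles n m)"
  using card_singles_multiples by (simp add: size_multi_eq)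

lemma count_edge_labels:
  "count (multi n m - mset_set (multiples n m)) e =
    (if e \<in> singles n m then 1 else if e \<in> multiples n m then m e - 1 else 0)"
  by (auto simp: count_multi count_mset_set' singles_def multiples_def)

context
  fixes r :: nat
  assumes r: "r \<le> excess"
begin

text \<open>Since \<open>r \<le> excess\<close>, removing \<open>r\<close> leaves exactly one
  integer for each gap.\<close>

lemma length_available: "(\<Sum>i=1..<Suc n. m i - 1) = length (sorted_list_of_set ({0..excess} - {r}))"
  using r by (simp add: excess_eq atLeastLessThanSuc_atLeastAtMost)

lemma length_slots: "e \<in> {1..n} \<Longrightarrow> length (slots r e) = m e - 1"
  unfolding slots_def by (rule length_slice[OF length_available])

lemma concat_slots: "concat (map (slots r) [1..<Suc n]) = sorted_list_of_set ({0..excess} - {r})"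
  unfolding slots_def by (rule concat_slice[OF length_available])

text \<open>Both halves of compatibility come from one fact: the concatenated blocks form a strictly
  increasing list.\<close>

lemma sorted_slots: "e \<in> {1..n} \<Longrightarrow> sorted_wrt (<) (slots r e)"
  and slots_less: "1 \<le> e1 \<Longrightarrow> e1 < e2 \<Longrightarrow> e2 \<le> n \<Longrightarrow> x \<in> set (slots r e1) \<Longrightarrow>
    y \<in> set (slots r e2) \<Longrightarrow> x < y"
proof -
  have "sorted_wrt (<) (concat (map (slots r) [1..<Suc n]))"
    unfolding concat_slots by simp
  then have *: "\<forall>e\<in>set [1..<Suc n]. sorted_wrt (<) (slots r e)"
    "sorted_wrt (\<lambda>e1 e2. \<forall>x\<in>set (slots r e1). \<forall>y\<in>set (slots r e2). x < y) [1..<Suc n]"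
    unfolding sorted_wrt_concat_map by blast+
  show "sorted_wrt (<) (slots r e)" if "e \<in> {1..n}"
    using *(1) that by (simp del: upt_Suc)
  show "x < y" if "1 \<le> e1" "e1 < e2" "e2 \<le> n" "x \<in> set (slots r e1)" "y \<in> set (slots r e2)"
    using *(2) that unfolding sorted_wrt_upt_iff by (simp add: less_Suc_eq_le)
qed

lemma set_slots: "(\<Union>e\<in>{1..n}. set (slots r e)) = {0..excess} - {r}"
proof -
  have "set (concat (map (slots r) [1..<Suc n])) = {0..excess} - {r}"
    unfolding concat_slots by simp
  then show ?thesis by (simp add: atLeastLessThanSuc_atLeastAtMost del: upt_Suc)
qed

lemma slots_singles: "e \<in> singles n m \<Longrightarrow> slots r e = []"
  using length_slots[of e] by (simp add: singles_def)

lemma length_canonical_labels: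
  "length (canonical_labels r e) = count (multi n m - mset_set (multiples n m)) e"
  unfolding count_edge_labels canonical_labels_def
  using length_slots[of e] singles_or_multiples[of e] by simp

lemma IntL_in_canonical_labels:
  "IntL x \<in> set (canonical_labels r e) \<longleftrightarrow> e \<in> {1..n} \<and> x \<in> set (slots r e)"
  using slots_singles[of e] singles_or_multiples[of e] by (auto simp: canonical_labels_def)

lemma SymL_in_canonical_labels:
  "SymL i \<in> set (canonical_labels r e) \<longleftrightarrow> e \<in> singles n m \<and> e = i"
  by (auto simp: canonical_labels_def)

lemma set_canonical_labels:
  "(\<Union>e. set (canonical_labels r e)) = IntL ` ({0..excess} - {r}) \<union> SymL ` singles n m"
proof (rule set_eqI)
  fix l
  show "l \<in> (\<Union>e. set (canonical_labels r e)) \<longleftrightarrow>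
    l \<in> IntL ` ({0..excess} - {r}) \<union> SymL ` singles n m"
  proof (cases l)
    case (IntL x)
    then show ?thesis
      unfolding set_slots[symmetric] by (auto simp: IntL_in_canonical_labels image_iff)
  next
    case (SymL i)
    then show ?thesis by (auto simp: SymL_in_canonical_labels)
  qed
qed

section \<open>Trees with root label \<open>r\<close> are the canonical forests\<close>

lemma ve_tree_of_canonical:
  assumes "canonical r cs"
  shows "Node (IntL r) cs \<in> ve_trees n m"
proof -
  have cl: "clustered None cs" and labels: "\<And>e. labels_at e cs = canonical_labels r e"
    using assms by (auto simp: canonical_def)
  let ?F = "forest_edges cs" and ?T = "Node (IntL r) cs"
  let ?V = "insert ?T (snd ` set ?F)"
  have mem: "root_label t \<in> set (canonical_labels r e)" if "(e, t) \<in> set ?F" for e t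
    using that labels set_labels_at by metis
  have mset: "mset (map fst ?F) = multi n m - mset_set (multiples n m)"
    by (rule multiset_eqI) (simp only: count_forest_labels labels length_canonical_labels)
  have "length ?F = size (mset (map fst ?F))"
    by simp
  also have "\<dots> = size (multi n m) - card (multiples n m)"
    unfolding mset by (simp add: size_Diff_submset mset_set_multiples_subset)
  finally have len: "length ?F = size (multi n m) - card (multiples n m)" .
  have "(root_label \<circ> snd) ` set ?F = (\<Union>e. set (labels_at e cs))"
    by (force simp: set_labels_at)
  also have "\<dots> = IntL ` ({0..excess} - {r}) \<union> SymL ` singles n m"
    unfolding labels by (rule set_canonical_labels)
  finally have set: "(root_label \<circ> snd) ` set ?F = IntL ` ({0..excess} - {r}) \<union> SymL ` singles n m" .
  \<comment> \<open>Distinctness by counting: the labels fill a set with as many elements as there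
    are edges.\<close>
  have "card (set (map (root_label \<circ> snd) ?F)) =
      card (IntL ` ({0..excess} - {r})) + card (SymL ` singles n m)"
    unfolding set_map set by (rule card_Un_disjoint) auto
  also have "\<dots> = excess + card (singles n m)"
    using r by (simp add: card_image inj_on_def)
  finally have "card (set (map (root_label \<circ> snd) ?F)) = length (map (root_label \<circ> snd) ?F)"
    using len number_of_edges by simp
  then have "distinct (map (root_label \<circ> snd) ?F)"
    by (rule card_distinct)
  moreover have "IntL r \<notin> (root_label \<circ> snd) ` set ?F"
    unfolding set by auto
  ultimately have dist: "distinct (IntL r # map (root_label \<circ> snd) ?F)"
    by simp
  have all: "insert (IntL r) ((root_label \<circ> snd) ` set ?F) =
      IntL ` {0..size (multi n m) - n} \<union> SymL ` singles n m"
    unfolding set excess_def[symmetric] using r by auto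
  have syms: "root_label t = SymL i \<longleftrightarrow> children t = [] \<and> e = i"
    if "(e, t) \<in> set ?F" "i \<in> singles n m" for e t i
  proof
    assume "root_label t = SymL i"
    then show "children t = [] \<and> e = i"
      using mem[OF that(1)] clustered_SymL[OF cl that(1)] by (simp add: SymL_in_canonical_labels)
  next
    assume "children t = [] \<and> e = i"
    then show "root_label t = SymL i"
      using mem[OF that(1)] that(2) by (simp add: canonical_labels_def)
  qed
  have parents: "t = u" if "t \<in> ?V" "u \<in> ?V" "fst ` set (children t) \<inter> fst ` set (children u) \<noteq> {}" for t u
  proof -
    \<comment> \<open>Labels below the root do not recur deeper, so \<open>t\<close> and
      \<open>u\<close> are both the root or both below it.\<close>
    have "\<not> (v = ?T \<and> w \<in> snd ` set ?F)" if "fst ` set (children v) \<inter> fst ` set (children w) \<noteq> {}" for v w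
    proof
      assume "v = ?T \<and> w \<in> snd ` set ?F"
      then show False using clustered_disjoint_child_labels[OF cl, of w] that by simp
    qed
    then have "t \<in> snd ` set ?F \<longleftrightarrow> u \<in> snd ` set ?F"
      using that by (metis Int_commute insertE)
    then show ?thesis
      using clustered_parent_unique[OF cl _ _ that(3)] that(1,2) by blast
  qed
  have contig: "contiguous (child_labels t)" if "t \<in> ?V" for t
    using that clustered_contiguous[OF cl] clustered_contiguous[OF clustered_children[OF cl]] by auto
  have "sorted_wrt sibling_increasing (filter (\<lambda>x. fst x = e) ?F)" for e
  proof (cases "e \<in> multiples n m")
    case True
    have "map (root_label \<circ> snd) (filter (\<lambda>x. fst x = e) ?F) = map IntL (slots r e)"
      using labels[of e] True singles_disjoint_multiples[of e n m]
      by (auto simp: labels_at_def canonical_labels_def)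
    moreover have "sorted_wrt (\<lambda>k l. \<exists>x y. k = IntL x \<and> l = IntL y \<and> x < y) (map IntL (slots r e))"
      using sorted_slots[of e] True by (simp add: sorted_wrt_map multiples_def)
    ultimately have "sorted_wrt (\<lambda>k l. \<exists>x y. k = IntL x \<and> l = IntL y \<and> x < y)
        (map (root_label \<circ> snd) (filter (\<lambda>x. fst x = e) ?F))"
      by simp
    then show ?thesis
      unfolding sibling_increasing_def[abs_def] by (simp add: sorted_wrt_map)
  next
    case False
    then have "length (filter (\<lambda>x. fst x = e) ?F) \<le> 1"
      using labels[of e] arg_cong[OF labels[of e], of length]
      by (auto simp: labels_at_def canonical_labels_def split: if_splits)
    then show ?thesis by (cases "filter (\<lambda>x. fst x = e) ?F") auto
  qed
  then have inc: "sorted_wrt (\<lambda>a b. fst a = fst b \<longrightarrow> sibling_increasing a b) ?F"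
    by (simp add: sorted_wrt_key_iff)
  have siblings: "sorted_wrt (\<lambda>a b. fst a = fst b \<longrightarrow> sibling_increasing a b) (children t)"
    if "t \<in> ?V" for t
  proof (cases "t = ?T")
    case True
    then show ?thesis using sorted_wrt_forest_edgesD(1)[OF inc] by simp
  next
    case False
    then show ?thesis using sorted_wrt_forest_edgesD(2)[OF inc] that by simp
  qed
  have compat: "fst a < fst b \<longleftrightarrow> x < y"
    if "a \<in> set ?F" "b \<in> set ?F" "fst a \<noteq> fst b" "root_label (snd a) = IntL x" "root_label (snd b) = IntL y"
    for a b x y
  proof -
    have "fst a \<in> {1..n} \<and> x \<in> set (slots r (fst a))" "fst b \<in> {1..n} \<and> y \<in> set (slots r (fst b))"
      using mem[of "fst a" "snd a"] mem[of "fst b" "snd b"] that IntL_in_canonical_labels by auto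
    then show ?thesis
      using slots_less[of "fst a" "fst b" x y] slots_less[of "fst b" "fst a" y x] that(3)
      by (cases "fst a < fst b") auto
  qed
  show ?thesis
    unfolding ve_trees_Node_iff
  proof (intro conjI, goal_cases)
    case 4
    show ?case by simp
  next
    case 5
    show ?case using syms by blast
  next
    case 7
    show ?case using parents by blast
  next
    case 8
    show ?case using contig by blast
  next
    case 9
    show ?case using siblings by blast
  next
    case 10
    show ?case using compat by blast
  qed (fact len dist all mset)+
qed

text \<open>The integers below the \<open>e\<close>-edges, taken for \<open>e = 1, ..., n\<close>,
  increase within a block by the order of siblings and across blocks by compatibility. Together they
  are all the integers but \<open>r\<close>, so they form the sorted list, and the block lengths fix
  where it is cut.\<close>

lemma canonical_of_ve_tree:
  assumes "Node (IntL r) cs \<in> ve_trees n m"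
  shows "canonical r cs"
proof -
  let ?F = "forest_edges cs" and ?T = "Node (IntL r) cs"
  let ?V = "insert ?T (snd ` set ?F)"
  have dist: "distinct (IntL r # map (root_label \<circ> snd) ?F)"
    and all: "insert (IntL r) ((root_label \<circ> snd) ` set ?F) = IntL ` {0..excess} \<union> SymL ` singles n m"
    and syms': "\<forall>(e, t)\<in>set ?F. \<forall>i\<in>singles n m. root_label t = SymL i \<longleftrightarrow> children t = [] \<and> e = i"
    and mset: "mset (map fst ?F) = multi n m - mset_set (multiples n m)"
    and parents': "\<forall>t\<in>?V. \<forall>u\<in>?V. fst ` set (children t) \<inter> fst ` set (children u) \<noteq> {} \<longrightarrow> t = u"
    and contig: "\<forall>t\<in>?V. contiguous (child_labels t)"
    and siblings: "\<forall>t\<in>?V. sorted_wrt (\<lambda>a b. fst a = fst b \<longrightarrow> sibling_increasing a b) (children t)"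
    and compat: "\<forall>a\<in>set ?F. \<forall>b\<in>set ?F. \<forall>x y.
      fst a \<noteq> fst b \<and> root_label (snd a) = IntL x \<and> root_label (snd b) = IntL y \<longrightarrow>
      (fst a < fst b \<longleftrightarrow> x < y)"
    using assms unfolding ve_trees_Node_iff excess_def by - (elim conjE, assumption)+
  note parents = parents'[rule_format]
  have syms: "root_label t = SymL i \<longleftrightarrow> children t = [] \<and> e = i"
    if "(e, t) \<in> set ?F" "i \<in> singles n m" for e t i
    using bspec[OF syms' that(1)] that(2) by simp
  have length_labels: "length (labels_at e cs) =
      (if e \<in> singles n m then 1 else if e \<in> multiples n m then m e - 1 else 0)" for e
    using count_forest_labels[of cs e] unfolding mset count_edge_labels by simp
  \<comment> \<open>The condition on symbols speaks of \<open>i\<close> in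
    \<open>singles n m\<close>; any other symbol is excluded by the set of all vertex
    labels.\<close>
  have sym_single: "i \<in> singles n m \<and> i = e \<and> children t = []"
    if "(e, t) \<in> set ?F" "root_label t = SymL i" for e t i
  proof -
    have "SymL i \<in> insert (IntL r) ((root_label \<circ> snd) ` set ?F)"
      using that by force
    then have "i \<in> singles n m" unfolding all by auto
    then show ?thesis using syms[OF that(1)] that(2) by blast
  qed
  have dist_trees: "distinct (map snd ?F)"
    using dist by (simp add: distinct_map) (metis inj_on_imageI2)
  have root_fresh: "?T \<notin> snd ` set ?F"
    using dist by force
  have clustered: "clustered None cs"
  proof (rule clusteredI[OF dist_trees], goal_cases)
    case (1 t u)
    then show ?case using parents by blast
  next
    case (2 t)
    then have "?T \<noteq> t" using root_fresh by blast
    then have "fst ` set (children ?T) \<inter> fst ` set (children t) = {}"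
      using parents[of ?T t] 2 by blast
    then show ?case by simp
  next
    case (3 t)
    then show ?case using contig by blast
  next
    case 4
    then show ?case using contig by simp
  next
    case (5 e t i)
    have e: "e \<in> singles n m" "i = e" "children t = []"
      using sym_single[OF 5] by auto
    have "u = t" if "(e, u) \<in> set ?F" for u
    proof -
      have "length (filter (\<lambda>x. fst x = e) ?F) = 1"
        using length_labels[of e] e(1) by (simp add: labels_at_def)
      then obtain a where "filter (\<lambda>x. fst x = e) ?F = [a]"
        by (auto simp: length_Suc_conv)
      then have "set (filter (\<lambda>x. fst x = e) ?F) = {a}" by simp
      moreover have "(e, u) \<in> set (filter (\<lambda>x. fst x = e) ?F)" "(e, t) \<in> set (filter (\<lambda>x. fst x = e) ?F)"
        using that 5 by simp_all
      ultimately show ?thesis by auto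
    qed
    then show ?case using e by simp
  qed
  \<comment> \<open>The \<open>0\<close> is a default value: \<open>labels_multiples\<close> shows
    that only integers occur below an edge with a repeated value.\<close>
  define xs where "xs e = (if e \<in> multiples n m
    then map (\<lambda>l. case l of IntL x \<Rightarrow> x | SymL _ \<Rightarrow> 0) (labels_at e cs) else [])" for e
  have labels_multiples: "labels_at e cs = map IntL (xs e)" if "e \<in> multiples n m" for e
  proof -
    have "\<exists>x. l = IntL x" if "l \<in> set (labels_at e cs)" for l
    proof (cases l)
      case (SymL i)
      then have "e \<in> singles n m" using that sym_single unfolding set_labels_at by blast
      then show ?thesis using \<open>e \<in> multiples n m\<close> singles_disjoint_multiples by blast
    qed simp
    then have "map (IntL \<circ> (\<lambda>l. case l of IntL x \<Rightarrow> x | SymL _ \<Rightarrow> 0)) (labels_at e cs) = labels_at e cs"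
      by (intro map_idI) fastforce
    then show ?thesis using that by (simp add: xs_def)
  qed
  have mem: "e \<in> multiples n m \<and> (\<exists>t. (e, t) \<in> set ?F \<and> root_label t = IntL x)" if "x \<in> set (xs e)" for e x
  proof -
    have e: "e \<in> multiples n m" using that by (auto simp: xs_def split: if_splits)
    then have "IntL x \<in> set (labels_at e cs)" using labels_multiples that by simp
    then show ?thesis using e by (simp add: set_labels_at)
  qed
  have "sorted_wrt (\<lambda>a b. fst a = fst b \<longrightarrow> sibling_increasing a b) cs"
    using bspec[OF siblings, of ?T] by simp
  then have "sorted_wrt (\<lambda>a b. fst a = fst b \<longrightarrow> sibling_increasing a b) ?F"
    by (rule sorted_wrt_forest_edgesI[OF clustered]) (rule bspec[OF siblings], rule insertI2)
  then have inc: "sorted_wrt sibling_increasing (filter (\<lambda>x. fst x = e) ?F)" for e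
    by (simp add: sorted_wrt_key_iff)
  have sorted_xs: "sorted_wrt (<) (xs e)" for e
  proof (cases "e \<in> multiples n m")
    case True
    have "sorted_wrt (\<lambda>k l. \<exists>x y. k = IntL x \<and> l = IntL y \<and> x < y) (labels_at e cs)"
      using inc[of e] unfolding sibling_increasing_def[abs_def]
      by (simp add: labels_at_def sorted_wrt_map)
    then show ?thesis unfolding labels_multiples[OF True] by (simp add: sorted_wrt_map)
  qed (simp add: xs_def)
  have sorted: "sorted_wrt (<) (concat (map xs [1..<Suc n]))"
    unfolding sorted_wrt_concat_map sorted_wrt_upt_iff
  proof (intro conjI ballI allI impI)
    fix e1 e2 x y assume "e1 < e2" "x \<in> set (xs e1)" "y \<in> set (xs e2)"
    then obtain t u where "(e1, t) \<in> set ?F" "root_label t = IntL x"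
      "(e2, u) \<in> set ?F" "root_label u = IntL y"
      using mem by meson
    then show "x < y" using compat[rule_format, of "(e1, t)" "(e2, u)" x y] \<open>e1 < e2\<close> by simp
  qed (rule sorted_xs)
  have set: "set (concat (map xs [1..<Suc n])) = {0..excess} - {r}"
  proof (intro equalityI subsetI)
    fix x assume "x \<in> set (concat (map xs [1..<Suc n]))"
    then obtain e where "x \<in> set (xs e)" by (auto simp del: upt_Suc)
    then obtain t where "(e, t) \<in> set ?F" "root_label t = IntL x"
      using mem by blast
    then have "IntL x \<in> (root_label \<circ> snd) ` set ?F" by force
    moreover from this have "IntL x \<in> IntL ` {0..excess} \<union> SymL ` singles n m"
      using all by blast
    moreover have "IntL r \<notin> (root_label \<circ> snd) ` set ?F" using dist by simp
    ultimately show "x \<in> {0..excess} - {r}" by auto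
  next
    fix x assume x: "x \<in> {0..excess} - {r}"
    then have "IntL x \<in> insert (IntL r) ((root_label \<circ> snd) ` set ?F)"
      unfolding all by simp
    then obtain e t where et: "(e, t) \<in> set ?F" "root_label t = IntL x"
      using x by force
    then have in_labels: "IntL x \<in> set (labels_at e cs)" by (auto simp: set_labels_at)
    \<comment> \<open>For a single value the one \<open>e\<close>-edge has to carry
      \<open>SymL e\<close>, which leaves no room for an integer.\<close>
    have "e \<notin> singles n m"
    proof
      assume e: "e \<in> singles n m"
      then have "SymL e \<in> insert (IntL r) ((root_label \<circ> snd) ` set ?F)" unfolding all by simp
      then obtain e' u where u: "(e', u) \<in> set ?F" "root_label u = SymL e" by force
      then have "e' = e" using sym_single by blast
      then have "SymL e \<in> set (labels_at e cs)" using u by (auto simp: set_labels_at)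
      moreover have "length (labels_at e cs) = 1" using length_labels[of e] e by simp
      ultimately show False using in_labels by (auto simp: length_Suc_conv)
    qed
    moreover have "labels_at e cs \<noteq> []" using in_labels by auto
    ultimately have e: "e \<in> multiples n m"
      using length_labels[of e] by (auto split: if_splits)
    then have "x \<in> set (xs e)" using in_labels labels_multiples by auto
    moreover have "e \<in> {1..n}" using e singles_or_multiples by blast
    ultimately show "x \<in> set (concat (map xs [1..<Suc n]))" by (auto simp: less_Suc_eq_le simp del: upt_Suc)
  qed
  have "concat (map xs [1..<Suc n]) = sorted_list_of_set ({0..excess} - {r})"
    by (rule strict_sorted_equal) (use sorted set in simp_all)
  then have concat: "concat (map xs [1..<Suc n]) = concat (map (slots r) [1..<Suc n])"
    using concat_slots by simp
  have length_xs: "length (xs e) = length (slots r e)" if "e \<in> {1..n}" for e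
    using that length_labels[of e] length_slots[OF that] singles_or_multiples[of e]
      singles_disjoint_multiples[of e n m]
    by (auto simp: xs_def singles_def)
  have xs: "xs e = slots r e" if "e \<in> {1..n}" for e
    by (rule concat_map_inj[OF concat]) (use that length_xs in auto)
  have "labels_at e cs = canonical_labels r e" for e
  proof -
    consider "e \<in> singles n m" | "e \<in> multiples n m" | "e \<notin> singles n m" "e \<notin> multiples n m"
      by blast
    then show ?thesis
    proof cases
      case 1
      then have "SymL e \<in> insert (IntL r) ((root_label \<circ> snd) ` set ?F)" unfolding all by simp
      then obtain e' u where u: "(e', u) \<in> set ?F" "root_label u = SymL e" by force
      then have "e' = e" using sym_single by blast
      then have "SymL e \<in> set (labels_at e cs)" using u by (auto simp: set_labels_at)
      moreover have "length (labels_at e cs) = 1" using length_labels[of e] 1 by simp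
      ultimately show ?thesis using 1 by (auto simp: length_Suc_conv canonical_labels_def)
    next
      case 2
      then show ?thesis
        using labels_multiples xs[of e] singles_or_multiples[of e] singles_disjoint_multiples[of e n m]
        by (auto simp: canonical_labels_def)
    next
      case 3
      then show ?thesis using length_labels[of e] by (simp add: canonical_labels_def)
    qed
  qed
  then show ?thesis using clustered by (simp add: canonical_def)
qed

section \<open>Canonical forests and quasi-Stirling permutations\<close>

lemma word_in_quasi_stirling:
  assumes "canonical r cs"
  shows "word None cs \<in> quasi_stirling n m"
proof -
  have cl: "clustered None cs" and labels: "\<And>e. labels_at e cs = canonical_labels r e"
    using assms by (auto simp: canonical_def)
  have "count (mset (word None cs)) e = count (multi n m) e" for e
  proof -
    have *: "count (mset (word None cs)) e =
        length (filter (\<lambda>l. l \<in> range IntL) (canonical_labels r e)) +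
        (if canonical_labels r e \<noteq> [] then 1 else 0)"
      using count_word[OF cl, of e] labels_at_eq_Nil_iff[of e cs] labels by auto
    consider "e \<in> singles n m" | "e \<in> multiples n m" | "e \<notin> {1..n}"
      using singles_or_multiples by blast
    then show ?thesis
    proof cases
      case 1
      then have "canonical_labels r e = [SymL e]" by (simp add: canonical_labels_def)
      then show ?thesis unfolding * using 1 by (auto simp: count_multi singles_def)
    next
      case 2
      then have "canonical_labels r e = map IntL (slots r e)"
        using singles_disjoint_multiples[of e n m] by (auto simp: canonical_labels_def)
      moreover have "length (slots r e) = m e - 1" "m e > 1" "e \<in> {1..n}"
        using 2 length_slots[of e] by (auto simp: multiples_def)
      moreover from this have "slots r e \<noteq> []" by auto
      ultimately show ?thesis unfolding * by (simp add: count_multi filter_map o_def)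
    next
      case 3
      then have "canonical_labels r e = []"
        using singles_or_multiples[of e] by (auto simp: canonical_labels_def)
      then show ?thesis unfolding * using 3 by (auto simp: count_multi)
    qed
  qed
  then have "mset (word None cs) = multi n m" by (rule multiset_eqI)
  moreover have "noncrossing (word None cs)" using noncrossing_word[OF cl] by simp
  ultimately show ?thesis
    by (auto simp: quasi_stirling_def permutations_of_multiset_def noncrossing_def)
qed

lemma decode_canonical:
  assumes "w \<in> quasi_stirling n m"
  shows "canonical r (decode (canonical_labels r) None w)"
    and "word None (decode (canonical_labels r) None w) = w"
proof -
  let ?D = "decode (canonical_labels r) None w"
  have w: "mset w = multi n m" "noncrossing w"
    using assms by (auto simp: quasi_stirling_def permutations_of_multiset_def noncrossing_def)
  have set: "set w = {1..n}"
  proof (rule set_eqI)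
    fix e
    have "e \<in> set w \<longleftrightarrow> 0 < count (multi n m) e"
      by (simp flip: w(1))
    then show "e \<in> set w \<longleftrightarrow> e \<in> {1..n}"
      using m_ge_1[of e] by (auto simp: count_multi)
  qed
  \<comment> \<open>No run is open at the start, so what has to be checked is the number of labels
    of unread letters.\<close>
  have *: "word None ?D = w \<and> clustered None ?D \<and> (\<forall>e\<in>set w. labels_at e ?D = canonical_labels r e)"
  proof (rule decode_correct, goal_cases)
    case (3 e)
    then have e: "e \<in> {1..n}" using set by simp
    show ?case
    proof (cases "e \<in> singles n m")
      case True
      then show ?thesis using e by (simp add: canonical_labels_def w count_multi singles_def)
    next
      case False
      then have "e \<in> multiples n m" using e singles_or_multiples by blast
      then show ?thesis
        using False e length_slots[OF e]
        by (auto simp: canonical_labels_def w count_multi multiples_def)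
    qed
  qed (use w in simp_all)
  show "word None ?D = w" using * by blast
  have "labels_at e ?D = canonical_labels r e" if "e \<notin> set w" for e
  proof -
    have "e \<notin> forest_labels ?D" using that * set_word[of None ?D] by auto
    moreover have "canonical_labels r e = []"
      using that singles_or_multiples[of e] by (auto simp: set canonical_labels_def)
    ultimately show ?thesis by simp
  qed
  then show "canonical r ?D" using * by (auto simp: canonical_def)
qed

lemma decode_word_canonical:
  "canonical r cs \<Longrightarrow> decode (canonical_labels r) None (word None cs) = cs"
  by (rule decode_word) (auto simp: canonical_def)

end

text \<open>The root has no edge above it, so the condition on symbols forces an integer
  there.\<close>

lemma ve_trees_iff:
  "T \<in> ve_trees n m \<longleftrightarrow> (\<exists>r\<le>excess. \<exists>cs. T = Node (IntL r) cs \<and> canonical r cs)"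
proof
  assume T: "T \<in> ve_trees n m"
  obtain l cs where Tl: "T = Node l cs" by (cases T)
  have "l \<in> IntL ` {0..excess} \<union> SymL ` singles n m" "\<forall>i\<in>singles n m. l \<noteq> SymL i"
    using T unfolding Tl ve_trees_Node_iff excess_def by blast+
  then obtain r where "r \<le> excess" "l = IntL r" by auto
  then show "\<exists>r\<le>excess. \<exists>cs. T = Node (IntL r) cs \<and> canonical r cs"
    using T Tl canonical_of_ve_tree by blast
qed (use ve_tree_of_canonical in blast)

lemma canonical_statistics:
  assumes "canonical r cs"
  shows "cdes (Node (IntL r) cs) = des (word None cs)"
    and "casc (Node (IntL r) cs) = asc (word None cs)"
    and "leaf_star (Node (IntL r) cs) = plat (word None cs)"
proof -
  have cl: "clustered None cs" using assms by (simp add: canonical_def)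
  have "labels_at 0 cs = []"
    using assms by (simp add: canonical_def canonical_labels_def singles_def multiples_def)
  then have "0 \<notin> forest_labels cs" by (simp add: labels_at_eq_Nil_iff)
  with cl show "cdes (Node (IntL r) cs) = des (word None cs)"
    "casc (Node (IntL r) cs) = asc (word None cs)"
    "leaf_star (Node (IntL r) cs) = plat (word None cs)"
    by (simp_all add: cdes_eq_des_word casc_eq_asc_word leaf_star_eq_plat_word)
qed

text \<open>A value \<open>k\<close> admits the \<open>m k - 1\<close> marks with
  \<open>2 \<le> j \<le> m k\<close>, as many as it has gaps. Matching the copies with
  \<open>{1..excess}\<close> leaves \<open>0\<close> free for \<open>Zero\<close>.\<close>

lemma ex_bij_marks:
  "\<exists>g. bij_betw g {0..excess} ({Zero} \<union> {Copy k j |k j. k \<in> {1..n} \<and> 2 \<le> j \<and> j \<le> m k}) \<and> g 0 = Zero"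
proof -
  let ?C = "{Copy k j |k j. k \<in> {1..n} \<and> 2 \<le> j \<and> j \<le> m k}"
  have C: "?C = (\<lambda>(k, j). Copy k j) ` (SIGMA k:{1..n}. {2..m k})" by auto
  have "card ?C = card (SIGMA k:{1..n}. {2..m k})"
    unfolding C by (rule card_image) (auto simp: inj_on_def)
  also have "\<dots> = excess"
    unfolding excess_eq by (simp add: Suc_diff_le cong: sum.cong)
  finally have "card {1..excess} = card ?C" by simp
  moreover have "finite ?C" unfolding C by (intro finite_imageI finite_SigmaI) auto
  ultimately obtain h where h: "bij_betw h {1..excess} ?C"
    using finite_same_card_bij[of "{1..excess}" ?C] by auto
  let ?g = "h(0 := Zero)"
  have "bij_betw ?g {1..excess} ?C"
    using h by (rule bij_betw_cong[THEN iffD1, rotated]) auto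
  moreover have "bij_betw ?g {0} {Zero}" by (simp add: bij_betw_def)
  ultimately have "bij_betw ?g ({0} \<union> {1..excess}) ({Zero} \<union> ?C)"
    by (intro bij_betw_combine) auto
  moreover have "{0} \<union> {1..excess} = {0..excess}" by auto
  ultimately show ?thesis by (intro exI[of _ ?g]) simp
qed

end

section \<open>The bijection between trees and rooted permutations\<close>

theorem theorem2p1:
  fixes n :: nat and m :: "nat \<Rightarrow> nat"
  assumes "\<forall>i\<in>{1..n}. m i \<ge> 1"
  shows "\<exists>\<phi> :: vetree \<Rightarrow> nat list \<times> mark.
    bij_betw \<phi> (ve_trees n m) (rooted_quasi_stirling n m) \<and>
    bij_betw \<phi> (ve_trees0 n m) {(\<pi>, Zero) |\<pi>. \<pi> \<in> quasi_stirling n m} \<and>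
    (\<forall>T \<in> ve_trees n m. \<forall>\<pi> r. \<phi> T = (\<pi>, r) \<longrightarrow>
      cdes T = des \<pi> \<and> casc T = asc \<pi> \<and> leaf_star T = plat \<pi>)"
proof -
  interpret multiplicities n m
    by unfold_locales (use assms in blast)
  let ?marks = "{Zero} \<union> {Copy k j |k j. k \<in> {1..n} \<and> 2 \<le> j \<and> j \<le> m k}"
  obtain g where g: "bij_betw g {0..excess} ?marks" "g 0 = Zero"
    using ex_bij_marks by blast
  \<comment> \<open>The word keeps no integer label; the second component records the root's, from
    which \<open>canonical_labels\<close> recovers the others.\<close>
  define \<phi> where "\<phi> T = (word None (children T),
    g (case root_label T of IntL r \<Rightarrow> r | SymL _ \<Rightarrow> 0))" for T
  have \<phi>: "\<phi> (Node (IntL r) cs) = (word None cs, g r)" for r cs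
    by (simp add: \<phi>_def)
  \<comment> \<open>Fixing the root label of the preimage serves both surjectivity claims, the
    second one with \<open>r = 0\<close>.\<close>
  have preimage: "(w, g r) \<in> \<phi> ` {T \<in> ve_trees n m. root_label T = IntL r}"
    if "w \<in> quasi_stirling n m" "r \<le> excess" for w r
  proof -
    let ?D = "decode (canonical_labels r) None w"
    have "\<phi> (Node (IntL r) ?D) = (w, g r)" "Node (IntL r) ?D \<in> ve_trees n m"
      using that decode_canonical ve_tree_of_canonical by (auto simp: \<phi>)
    then show ?thesis by (metis (mono_tags, lifting) imageI mem_Collect_eq vetree.sel(1))
  qed
  have "inj_on \<phi> (ve_trees n m)"
  proof (rule inj_onI)
    fix T T' assume "T \<in> ve_trees n m" "T' \<in> ve_trees n m" "\<phi> T = \<phi> T'"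
    then obtain r cs r' cs' where T: "T = Node (IntL r) cs" "r \<le> excess" "canonical r cs"
      and T': "T' = Node (IntL r') cs'" "r' \<le> excess" "canonical r' cs'"
      and eq: "word None cs = word None cs'" "g r = g r'"
      unfolding ve_trees_iff by (auto simp: \<phi>)
    have "r = r'"
      using bij_betw_imp_inj_on[OF g(1)] eq(2) T(2) T'(2) by (auto dest: inj_onD)
    \<comment> \<open>With equal root labels the same \<open>canonical_labels r\<close> decodes both
      words.\<close>
    moreover from this have "cs = cs'"
      using decode_word_canonical eq(1) T T' by metis
    ultimately show "T = T'" using T T' by simp
  qed
  moreover have image: "\<phi> ` ve_trees n m = rooted_quasi_stirling n m"
  proof (intro equalityI subsetI)
    fix x assume "x \<in> \<phi> ` ve_trees n m"
    then obtain T where T: "T \<in> ve_trees n m" "x = \<phi> T" by blast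
    from T(1) obtain r cs where "r \<le> excess" "canonical r cs" "T = Node (IntL r) cs"
      unfolding ve_trees_iff by blast
    then have "r \<le> excess" "canonical r cs" "x = (word None cs, g r)"
      using T(2) by (simp_all add: \<phi>)
    moreover from this have "g r \<in> ?marks"
      using bij_betwE[OF g(1)] by simp
    ultimately show "x \<in> rooted_quasi_stirling n m"
      unfolding rooted_quasi_stirling_def using word_in_quasi_stirling by blast
  next
    fix x assume "x \<in> rooted_quasi_stirling n m"
    then obtain w k where x: "x = (w, k)" "w \<in> quasi_stirling n m" "k \<in> ?marks"
      unfolding rooted_quasi_stirling_def by blast
    then obtain r where "r \<le> excess" "k = g r"
      using bij_betw_imp_surj_on[OF g(1)] by (metis (no_types, lifting) atLeastAtMost_iff imageE)
    then show "x \<in> \<phi> ` ve_trees n m" using preimage x by blast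
  qed
  ultimately have bij: "bij_betw \<phi> (ve_trees n m) (rooted_quasi_stirling n m)"
    by (simp add: bij_betw_def)
  have "\<phi> ` ve_trees0 n m = {(\<pi>, Zero) |\<pi>. \<pi> \<in> quasi_stirling n m}"
  proof (intro equalityI subsetI)
    fix x assume "x \<in> \<phi> ` ve_trees0 n m"
    then obtain T where T: "T \<in> ve_trees n m" "root_label T = IntL 0" "x = \<phi> T"
      unfolding ve_trees0_def by blast
    then obtain cs where "canonical 0 cs" "x = (word None cs, Zero)"
      unfolding ve_trees_iff by (auto simp: \<phi> g(2))
    then show "x \<in> {(\<pi>, Zero) |\<pi>. \<pi> \<in> quasi_stirling n m}"
      using word_in_quasi_stirling by blast
  next
    fix x assume "x \<in> {(\<pi>, Zero) |\<pi>. \<pi> \<in> quasi_stirling n m}"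
    then show "x \<in> \<phi> ` ve_trees0 n m"
      using preimage[of _ 0] by (auto simp: ve_trees0_def g(2))
  qed
  then have "bij_betw \<phi> (ve_trees0 n m) {(\<pi>, Zero) |\<pi>. \<pi> \<in> quasi_stirling n m}"
    by (rule bij_betw_subset[OF bij, rotated]) (auto simp: ve_trees0_def)
  moreover have "cdes T = des \<pi> \<and> casc T = asc \<pi> \<and> leaf_star T = plat \<pi>"
    if "T \<in> ve_trees n m" "\<phi> T = (\<pi>, k)" for T \<pi> k
    using that unfolding ve_trees_iff by (auto simp: \<phi> canonical_statistics)
  ultimately show ?thesis using bij by blast
qed

end
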